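(* Let $Q$ be a distribution over $\{\pm1\}^k$ (equivalently, a clause distribution over $k$-clauses) of distribution complexity $r$. Consider any (randomized) statistical algorithm that is given access to a distribution $D$ over $X_k$ which equals $U_k$ with probability $1/2$ and equals $Q_\sigma$ with probability $1/2$ for a uniformly random $\sigma\in\{\pm1\}^n$, and that decides correctly whether $D=Q_\sigma$ or $D=U_k$ with probability at least $2/3$. Then the algorithm needs either (1) $\Omega(q)$ calls to ${\rm VSTAT}\!\left(\frac{n^r}{(\log q)^r}\right)$, for any $q\ge1$, or (2) $\Omega\!\left(\left(\frac{n}{\log n}\right)^r\right)$ calls to 1-STAT. (Implied constants may depend on $k$ and $Q$.)
   Context: Fix integers $k\ge1$, $n\ge k$. A $k$-clause is an ordered $k$-tuple of literals from $x_1,\dots,x_n,\bar x_1,\dots,\bar x_n$ with no variable repeated; $X_k$ is the set of all $k$-clauses and $U_k$ is the uniform distribution on $X_k$. For $\sigma\in\{\pm1\}^n$ and $C=(l_1,\dots,l_k)\in X_k$, $\sigma(C)\in\{\pm1\}^k$ is the vector of values of the literals $l_1,\dots,l_k$ under $\sigma$, with $-1$ meaning TRUE and $1$ meaning FALSE. For a probability distribution $Q$ on $\{\pm1\}^k$, the planted distribution $Q_\sigma$ on $X_k$ is $Q_\sigma(C)=Q(\sigma(C))/\sum_{C'\in X_k}Q(\sigma(C'))$. The Fourier coefficient of $Q$ at $S\subseteq[k]$ is $\hat Q(S)=2^{-k}\sum_{y\in\{\pm1\}^k}Q(y)\prod_{i\in S}y_i$; the distribution complexity of $Q$ is the smallest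 integer $r\ge1$ for which some $S\subseteq[k]$ with $|S|=r$ has $\hat Q(S)\neq0$. Oracles for an unknown distribution $D$ over a finite set $X$: 1-STAT, given a query $h:X\to\{0,1\}$, draws a fresh sample $x\sim D$ and returns $h(x)$; ${\rm VSTAT}(t)$ (integer $t>0$), given $h:X\to\{0,1\}$, returns some value $v\in[p-\tau,p+\tau]$ where $p=\mathbb{E}_D[h]$ and $\tau=\max\{1/t,\sqrt{p(1-p)/t}\}$, the value being otherwise arbitrary (possibly adversarial). A statistical algorithm accesses the input distribution only through queries to such an oracle and must succeed for every valid sequence of oracle answers.
   Formalization: In (1) the oracle is VSTAT(γ·n^r/(log q)^r) with a constant γ>0 depending on k and Q: with γ=1 the bound fails, e.g. for k=r=3 and Q uniform on y1y2y3=1, where about q^0.85 random parity queries suffice (natural log). *)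

theory Defs
  imports "HOL-Probability.Probability"
begin

definition cube :: "nat \<Rightarrow> int list set" where
  "cube n = {y. length y = n \<and> set y \<subseteq> {1, -1}}"

text \<open>Variables are numbered from \<open>0\<close> to \<open>n - 1\<close>.\<close>

datatype literal = Pos (var: nat) | Neg (var: nat)

type_synonym clause = "literal list"

definition clauses :: "nat \<Rightarrow> nat \<Rightarrow> clause set" where
  "clauses k n = {C. length C = k \<and> distinct (map var C) \<and> (\<forall>l\<in>set C. var l < n)}"

text \<open>The value \<open>-1\<close> is TRUE and \<open>1\<close> is FALSE, so negating a literal flips the sign.\<close>

fun literal_value :: "int list \<Rightarrow> literal \<Rightarrow> int" where
  "literal_value \<sigma> (Pos i) = \<sigma> ! i"
| "literal_value \<sigma> (Neg i) = - (\<sigma> ! i)"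

definition clause_value :: "int list \<Rightarrow> clause \<Rightarrow> int list" where
  "clause_value \<sigma> C = map (literal_value \<sigma>) C"

definition uniform_clauses :: "nat \<Rightarrow> nat \<Rightarrow> clause pmf" where
  "uniform_clauses k n = pmf_of_set (clauses k n)"

definition planted_mass :: "nat \<Rightarrow> nat \<Rightarrow> int list pmf \<Rightarrow> int list \<Rightarrow> clause \<Rightarrow> real" where
  "planted_mass k n Q \<sigma> C =
     (if C \<in> clauses k n
      then pmf Q (clause_value \<sigma> C) / (\<Sum>C'\<in>clauses k n. pmf Q (clause_value \<sigma> C'))
      else 0)"

text \<open>That \<open>embed_pmf\<close> is applied to a genuine mass function here is \<open>pmf_planted\<close> below.\<close>

definition planted :: "nat \<Rightarrow> nat \<Rightarrow> int list pmf \<Rightarrow> int list \<Rightarrow> clause pmf" where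
  "planted k n Q \<sigma> = embed_pmf (planted_mass k n Q \<sigma>)"

definition fourier_coeff :: "nat \<Rightarrow> int list pmf \<Rightarrow> nat set \<Rightarrow> real" where
  "fourier_coeff k Q S = (\<Sum>y\<in>cube k. pmf Q y * (\<Prod>i\<in>S. real_of_int (y ! i))) / 2 ^ k"

definition has_distribution_complexity :: "nat \<Rightarrow> int list pmf \<Rightarrow> nat \<Rightarrow> bool" where
  "has_distribution_complexity k Q r \<longleftrightarrow>
     1 \<le> r \<and>
     (\<exists>S\<subseteq>{..<k}. card S = r \<and> fourier_coeff k Q S \<noteq> 0) \<and>
     (\<forall>s\<ge>1. (\<exists>S\<subseteq>{..<k}. card S = s \<and> fourier_coeff k Q S \<noteq> 0) \<longrightarrow> r \<le> s)"

text \<open>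
  A randomized algorithm maps the transcript of queries and answers so far to the distribution
  of its next move: a further query (\<open>Inl\<close>) or a final decision (\<open>Inr\<close>).  Private coins that
  persist between moves are covered, by passing to the distribution of the next move conditional
  on the transcript.  Answers to queries may likewise depend on the transcript.
\<close>

type_synonym 'x query = "'x \<Rightarrow> bool"

type_synonym ('q, 'a) transcript = "('q \<times> 'a) list"

type_synonym ('q, 'a) algorithm = "('q, 'a) transcript \<Rightarrow> ('q + bool) pmf"

type_synonym ('q, 'a) stat_oracle = "('q, 'a) transcript \<Rightarrow> 'q \<Rightarrow> 'a pmf"

text \<open>
  \<open>run m A orc []\<close> is the decision reached with at most \<open>m\<close> calls to \<open>orc\<close>; \<open>None\<close> means that the
  algorithm attempted a further call.
\<close>

primrec run ::
  "nat \<Rightarrow> ('q, 'a) algorithm \<Rightarrow> ('q, 'a) stat_oracle \<Rightarrow> ('q, 'a) transcript \<Rightarrow> bool option pmf"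
where
  "run 0 A orc h = bind_pmf (A h)
     (\<lambda>move. case move of Inl q \<Rightarrow> return_pmf None | Inr b \<Rightarrow> return_pmf (Some b))"
| "run (Suc m) A orc h = bind_pmf (A h)
     (\<lambda>move. case move of
        Inl q \<Rightarrow> bind_pmf (orc h q) (\<lambda>a. run m A orc (h @ [(q, a)]))
      | Inr b \<Rightarrow> return_pmf (Some b))"

definition one_stat :: "'x pmf \<Rightarrow> ('x query, bool) stat_oracle" where
  "one_stat D = (\<lambda>_ h. map_pmf h D)"

definition vstat_tolerance :: "real \<Rightarrow> real \<Rightarrow> real" where
  "vstat_tolerance t p = max (1 / t) (sqrt (p * (1 - p) / t))"

text \<open>The possibly adversarial answering strategies allowed to VSTAT with parameter \<open>t > 0\<close>.\<close>

definition valid_vstat ::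
  "real \<Rightarrow> 'x pmf \<Rightarrow> (('x query, real) transcript \<Rightarrow> 'x query \<Rightarrow> real) \<Rightarrow> bool"
where
  "valid_vstat t D v \<longleftrightarrow>
     (\<forall>H h. let p = measure_pmf.expectation D (\<lambda>x. of_bool (h x)); \<tau> = vstat_tolerance t p
            in v H h \<in> {p - \<tau>..p + \<tau>})"

text \<open>The label \<open>True\<close> marks the planted case.\<close>

definition random_instance :: "nat \<Rightarrow> nat \<Rightarrow> int list pmf \<Rightarrow> (bool \<times> clause pmf) pmf" where
  "random_instance k n Q = bind_pmf (bernoulli_pmf (1 / 2))
     (\<lambda>b. if b then map_pmf (\<lambda>\<sigma>. (True, planted k n Q \<sigma>)) (pmf_of_set (cube n))
          else return_pmf (False, uniform_clauses k n))"

definition success_prob ::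
  "nat \<Rightarrow> nat \<Rightarrow> int list pmf \<Rightarrow> nat \<Rightarrow> (clause query, 'a) algorithm
     \<Rightarrow> (clause pmf \<Rightarrow> (clause query, 'a) stat_oracle) \<Rightarrow> real"
where
  "success_prob k n Q m A orc =
     pmf (bind_pmf (random_instance k n Q)
            (\<lambda>(b, D). map_pmf (\<lambda>out. out = Some b) (run m A (orc D) []))) True"

definition solves_with_vstat ::
  "nat \<Rightarrow> nat \<Rightarrow> int list pmf \<Rightarrow> real \<Rightarrow> nat \<Rightarrow> (clause query, real) algorithm \<Rightarrow> bool"
where
  "solves_with_vstat k n Q t m A \<longleftrightarrow>
     (\<forall>v. (\<forall>D. valid_vstat t D (v D)) \<longrightarrow>
        success_prob k n Q m A (\<lambda>D H h. return_pmf (v D H h)) \<ge> 2 / 3)"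

definition solves_with_one_stat ::
  "nat \<Rightarrow> nat \<Rightarrow> int list pmf \<Rightarrow> nat \<Rightarrow> (clause query, bool) algorithm \<Rightarrow> bool"
where
  "solves_with_one_stat k n Q m A \<longleftrightarrow> success_prob k n Q m A one_stat \<ge> 2 / 3"

lemma finite_cube: "finite (cube n)"
proof -
  have "cube n = {y. set y \<subseteq> {1, -1} \<and> length y = n}" by (auto simp: cube_def)
  then show ?thesis using finite_lists_length_eq[of "{1, -1 :: int}" n] by simp
qed

lemma cube_nonempty: "cube n \<noteq> {}"
proof -
  have "replicate n 1 \<in> cube n" by (auto simp: cube_def)
  then show ?thesis by blast
qed

lemma finite_clauses: "finite (clauses k n)"
proof -
  let ?L = "Pos ` {..<n} \<union> Neg ` {..<n}"
  have "l \<in> ?L" if "var l < n" for l using that by (cases l) auto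
  then have "clauses k n \<subseteq> {C. set C \<subseteq> ?L \<and> length C = k}"
    unfolding clauses_def by blast
  then show ?thesis using finite_lists_length_eq[of ?L k] finite_subset by blast
qed

lemma clause_value_surj:
  assumes "k \<le> n" "\<sigma> \<in> cube n" "y \<in> cube k"
  shows "\<exists>C\<in>clauses k n. clause_value \<sigma> C = y"
proof
  let ?C = "map (\<lambda>i. if y ! i = \<sigma> ! i then Pos i else Neg i) [0..<k]"
  have "map var ?C = [0..<k]" by (rule nth_equalityI) auto
  then show "?C \<in> clauses k n"
    using assms(1) unfolding clauses_def by auto
  show "clause_value \<sigma> ?C = y"
  proof (rule nth_equalityI)
    show "length (clause_value \<sigma> ?C) = length y"
      using assms(3) by (simp add: clause_value_def cube_def)
    fix i assume "i < length (clause_value \<sigma> ?C)"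
    then have i: "i < k" by (simp add: clause_value_def)
    have "y ! i \<in> {1, -1}"
      using i assms(3) nth_mem[of i y] unfolding cube_def by blast
    moreover have "\<sigma> ! i \<in> {1, -1}"
      using i assms(1,2) nth_mem[of i \<sigma>] less_le_trans[of i k n] unfolding cube_def by blast
    ultimately show "clause_value \<sigma> ?C ! i = y ! i"
      using i by (auto simp: clause_value_def)
  qed
qed

lemma clauses_nonempty: "k \<le> n \<Longrightarrow> clauses k n \<noteq> {}"
  using clause_value_surj[of k n] cube_nonempty by blast

lemma pmf_planted:
  assumes "k \<le> n" "\<sigma> \<in> cube n" "set_pmf Q \<subseteq> cube k"
  shows "pmf (planted k n Q \<sigma>) C = planted_mass k n Q \<sigma> C"
proof -
  let ?Z = "\<Sum>C'\<in>clauses k n. pmf Q (clause_value \<sigma> C')"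
  obtain y where y: "y \<in> set_pmf Q" using set_pmf_not_empty by fast
  then obtain C0 where C0: "C0 \<in> clauses k n" "clause_value \<sigma> C0 = y"
    using clause_value_surj[OF assms(1,2)] assms(3) by blast
  have "0 < pmf Q (clause_value \<sigma> C0)" using y C0(2) by (simp add: pmf_positive)
  then have Z: "?Z > 0"
    using C0(1) finite_clauses by (intro sum_pos2[of _ C0]) auto
  have nn: "0 \<le> planted_mass k n Q \<sigma> C" for C
    using Z by (simp add: planted_mass_def)
  have "(\<integral>\<^sup>+ C. ennreal (planted_mass k n Q \<sigma> C) \<partial>count_space UNIV)
      = (\<Sum>C\<in>clauses k n. ennreal (planted_mass k n Q \<sigma> C))"
    by (rule nn_integral_count_space') (auto simp: finite_clauses planted_mass_def)
  also have "\<dots> = ennreal (\<Sum>C\<in>clauses k n. planted_mass k n Q \<sigma> C)"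
    using nn by (simp add: sum_ennreal)
  also have "(\<Sum>C\<in>clauses k n. planted_mass k n Q \<sigma> C)
      = (\<Sum>C\<in>clauses k n. pmf Q (clause_value \<sigma> C) / ?Z)"
    by (rule sum.cong) (auto simp: planted_mass_def)
  also have "\<dots> = 1" using Z by (simp add: sum_divide_distrib[symmetric])
  finally have "(\<integral>\<^sup>+ C. ennreal (planted_mass k n Q \<sigma> C) \<partial>count_space UNIV) = 1" by simp
  then show ?thesis unfolding planted_def using nn by (intro pmf_embed_pmf) auto
qed

end

theory Submission
  imports Defs
begin

text \<open>
  For a query \<open>h\<close>, the deviation \<open>p\<^sub>\<sigma>(h) - p\<^sub>U(h)\<close> of its acceptance probability under the planted
  distribution from that under the uniform one is a polynomial in \<open>\<sigma>\<close> whose monomials have degrees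
  between \<open>r\<close> and \<open>k\<close>.  Since a variable set of size \<open>l\<close> is hit with probability \<open>O(n\<^sup>-\<^sup>l)\<close>, its
  coefficients have squared norm \<open>O(p\<^sub>U(h) n\<^sup>-\<^sup>r)\<close>, and hypercontractivity bounds its \<open>2j\<close>-th moment
  by \<open>O(p\<^sub>U(h) (j / n)\<^sup>r)\<^sup>j\<close>.

  VSTAT: let the adversary answer \<open>p\<^sub>U(h)\<close> whenever this is allowed.  Markov's inequality with
  \<open>j \<approx> ln q\<close> shows that each query rules out a fraction of at most \<open>1 / q\<close> of the assignments.

  1-STAT: the case \<open>j = 1\<close> bounds the chi-square divergence of a one-bit answer, averaged over \<open>\<sigma>\<close>,
  by \<open>O(n\<^sup>-\<^sup>r)\<close>.  The triangular discrimination of the transcripts grows by at most a constant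
  times this amount per query; its increments are weighted by the uniform run alone, which is why
  one can average over \<open>\<sigma>\<close> in spite of the adaptivity.  This gives \<open>\<Omega>(n\<^sup>r)\<close> calls.
\<close>

section \<open>Even moments of polynomials on the cube\<close>

abbreviation character :: "nat set \<Rightarrow> int list \<Rightarrow> real" where
  "character S y \<equiv> (\<Prod>i\<in>S. real_of_int (y ! i))"

lemma card_cube: "card (cube n) = 2 ^ n"
proof -
  have "cube n = {y. set y \<subseteq> {1, -1} \<and> length y = n}" by (auto simp: cube_def)
  then show ?thesis using card_lists_length_eq[of "{1, -1 :: int}" n]
    by (simp add: numeral_2_eq_2)
qed

lemma cube_nth: "y \<in> cube n \<Longrightarrow> i < n \<Longrightarrow> y ! i = 1 \<or> y ! i = -1"
  using nth_mem[of i y] unfolding cube_def by blast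

lemma sum_cube_Suc:
  fixes F :: "int list \<Rightarrow> real"
  shows "(\<Sum>\<sigma>\<in>cube (Suc n). F \<sigma>) = (\<Sum>\<sigma>\<in>cube n. F (\<sigma> @ [1]) + F (\<sigma> @ [-1]))"
proof -
  let ?e = "\<lambda>x \<sigma>. \<sigma> @ [x :: int]"
  have "cube (Suc n) = ?e 1 ` cube n \<union> ?e (-1) ` cube n" (is "_ = ?R")
  proof
    show "cube (Suc n) \<subseteq> ?R"
    proof
      fix y assume y: "y \<in> cube (Suc n)"
      then obtain z x where "y = z @ [x]"
        by (cases y rule: rev_cases) (auto simp: cube_def)
      then show "y \<in> ?R" using y by (auto simp: cube_def)
    qed
  qed (auto simp: cube_def)
  moreover have "?e 1 ` cube n \<inter> ?e (-1) ` cube n = {}" by auto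
  moreover have "inj_on (?e x) (cube n)" for x by (auto simp: inj_on_def)
  ultimately show ?thesis
    by (simp add: sum.union_disjoint finite_cube sum.reindex sum.distrib)
qed

text \<open>As long as \<open>i < j\<close>, passing from \<open>i\<close> to \<open>i + 1\<close>
  multiplies the quotient of the two binomials by \<open>(2j - 2i - 1) / (2i + 1)\<close>, which is
  at most \<open>2j - 1\<close>. This comparison supplies the hypercontractive weight.\<close>

lemma binomial_double_le:
  assumes "1 \<le> j"
  shows "real (2 * j choose (2 * i)) \<le> (2 * real j - 1) ^ i * real (j choose i)"
proof (induction i)
  case 0
  then show ?case by simp
next
  case (Suc i)
  have absorb: "real (Suc l) * real (n choose Suc l) = (real n - real l) * real (n choose l)"
    if "l \<le> n" for l n :: nat
  proof -
    have "Suc l * (n choose Suc l) = (n - l) * (n choose l)"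
      by (simp only: binomial_absorption binomial_absorb_comp)
    then have "real (Suc l * (n choose Suc l)) = real ((n - l) * (n choose l))" by simp
    then show ?thesis using that by (simp add: of_nat_diff algebra_simps)
  qed
  show ?case
  proof (cases "i < j")
    case False
    then have "2 * j choose (2 * Suc i) = 0" "j choose Suc i = 0" by simp_all
    then show ?thesis by (simp only: of_nat_0 mult_zero_right order_refl)
  next
    case True
    let ?x = "real i" and ?y = "real j"
    let ?B = "real (2 * j choose (2 * i))" and ?B' = "real (2 * j choose (2 * Suc i))"
    let ?b = "real (j choose i)" and ?b' = "real (j choose Suc i)"
    have 1: "(2 * ?x + 1) * real (2 * j choose Suc (2 * i)) = (2 * ?y - 2 * ?x) * ?B"
      using absorb[of "2 * i" "2 * j"] True by (simp add: algebra_simps)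
    have 2: "(2 * ?x + 2) * ?B' = (2 * ?y - 2 * ?x - 1) * real (2 * j choose Suc (2 * i))"
      using absorb[of "Suc (2 * i)" "2 * j"] True by (simp add: algebra_simps)
    have 3: "(?x + 1) * ?b' = (?y - ?x) * ?b"
      using absorb[of i j] True by (simp add: algebra_simps)
    have "(2 * ?x + 1) * (2 * ?x + 2) * ?B'
        = (2 * ?y - 2 * ?x - 1) * ((2 * ?x + 1) * real (2 * j choose Suc (2 * i)))"
      by (simp only: mult.assoc 2) (simp only: mult_ac)
    also have "\<dots> = (2 * ?y - 2 * ?x - 1) * (2 * ?y - 2 * ?x) * ?B"
      by (simp only: 1 mult.assoc)
    also have "\<dots> \<le> (2 * ?y - 2 * ?x - 1) * (2 * ?y - 2 * ?x) * ((2 * ?y - 1) ^ i * ?b)"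
      using True by (intro mult_left_mono Suc.IH) auto
    also have "\<dots> = (2 * ?y - 2 * ?x - 1) * (2 * ?y - 1) ^ i * (2 * ((?y - ?x) * ?b))"
      by (simp add: algebra_simps)
    also have "\<dots> = (2 * ?y - 2 * ?x - 1) * ((2 * ?y - 1) ^ i * (2 * ?x + 2) * ?b')"
      unfolding 3[symmetric] by (simp add: algebra_simps)
    also have "\<dots> \<le> ((2 * ?x + 1) * (2 * ?y - 1)) * ((2 * ?y - 1) ^ i * (2 * ?x + 2) * ?b')"
    proof (intro mult_right_mono mult_nonneg_nonneg zero_le_power)
      \<comment> \<open>The two sides of the claim differ by \<open>4 * ?x * ?y\<close>.\<close>
      have "0 \<le> ?x * ?y" by simp
      then show "2 * ?y - 2 * ?x - 1 \<le> (2 * ?x + 1) * (2 * ?y - 1)" by (simp add: algebra_simps)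
    qed (use assms in auto)
    finally have "((2 * ?x + 1) * (2 * ?x + 2)) * ?B'
        \<le> ((2 * ?x + 1) * (2 * ?x + 2)) * ((2 * ?y - 1) ^ Suc i * ?b')"
      by (simp add: algebra_simps)
    then show ?thesis by (rule mult_left_le_imp_le) (auto intro!: mult_pos_pos add_nonneg_pos)
  qed
qed

text \<open>Odd powers of \<open>g\<close> cancel between the two expansions; even ones
  double.\<close>

lemma sum_even_binomial:
  fixes g h :: real
  shows "(h + g) ^ (2 * j) + (h - g) ^ (2 * j)
    = 2 * (\<Sum>i\<le>j. real (2 * j choose (2 * i)) * (g ^ (2 * i) * h ^ (2 * (j - i))))"
proof -
  let ?f = "\<lambda>l. real (2 * j choose l) * g ^ l * h ^ (2 * j - l)"
  have "(h + g) ^ (2 * j) + (h - g) ^ (2 * j)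
      = (\<Sum>l\<le>2 * j. ?f l + real (2 * j choose l) * (- g) ^ l * h ^ (2 * j - l))"
    using binomial_ring[of g h "2 * j"] binomial_ring[of "- g" h "2 * j"]
    by (simp add: sum.distrib add.commute)
  also have "\<dots> = (\<Sum>l\<le>2 * j. if even l then 2 * ?f l else 0)"
    by (rule sum.cong) auto
  also have "\<dots> = (\<Sum>l\<in>{l. l \<le> 2 * j \<and> even l}. 2 * ?f l)"
    by (rule sum.mono_neutral_cong_right) auto
  also have "\<dots> = (\<Sum>i\<le>j. 2 * ?f (2 * i))"
    by (rule sum.reindex_bij_witness[of _ "\<lambda>i. 2 * i" "\<lambda>l. l div 2"]) auto
  finally show ?thesis
    by (simp add: sum_distrib_left mult.assoc right_diff_distrib')
qed

text \<open>Weighted AM-GM for \<open>x ^ j\<close> and \<open>y ^ j\<close>, the pointwise half of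
  the Hoelder inequality below.\<close>

lemma weighted_power_mean:
  fixes x y :: real
  assumes "0 \<le> x" "0 \<le> y" "0 < i" "i < j"
  shows "x ^ i * y ^ (j - i) \<le> (real i / real j) * x ^ j + (1 - real i / real j) * y ^ j"
proof (cases "x = 0 \<or> y = 0")
  case True
  have "0 \<le> 1 - real i / real j" using assms by simp
  then show ?thesis using True assms by (auto simp: zero_power)
next
  case False
  then have pos: "0 < x" "0 < y" using assms by auto
  have "(x ^ j) powr (real i / real j) * (y ^ j) powr (1 - real i / real j)
      \<le> (real i / real j) * x ^ j + (1 - real i / real j) * y ^ j"
    using pos assms by (intro Youngs_inequality_0) auto
  moreover have "(x ^ j) powr (real i / real j) = x ^ i"
    using pos assms by (simp add: powr_realpow[symmetric] powr_powr)
  moreover have "real j * (1 - real i / real j) = real (j - i)"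
    using assms by (simp add: field_simps of_nat_diff)
  then have "(y ^ j) powr (1 - real i / real j) = y ^ (j - i)"
    using pos assms by (simp add: powr_realpow[symmetric] powr_powr)
  ultimately show ?thesis by simp
qed

text \<open>Hoelder's inequality with exponents \<open>j / i\<close> and \<open>j / (j - i)\<close>,
  applied to the squares of \<open>g\<close> and \<open>h\<close>; at \<open>i = 0\<close> and
  \<open>i = j\<close> it is one of the two hypotheses.\<close>

lemma mixed_moment_le:
  fixes g h :: "'a \<Rightarrow> real"
  assumes fin: "finite S" and "1 \<le> j" "i \<le> j" "0 \<le> A" "0 \<le> B" "0 \<le> N"
    and g: "(\<Sum>s\<in>S. g s ^ (2 * j)) \<le> N * A ^ j"
    and h: "(\<Sum>s\<in>S. h s ^ (2 * j)) \<le> N * B ^ j"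
  shows "(\<Sum>s\<in>S. g s ^ (2 * i) * h s ^ (2 * (j - i))) \<le> N * (A ^ i * B ^ (j - i))"
proof (cases "i = 0 \<or> i = j")
  case True
  then show ?thesis using g h by auto
next
  case False
  then have i: "0 < i" "i < j" using assms by auto
  have vanish: "f s = 0" if "(\<Sum>s\<in>S. f s ^ (2 * j)) \<le> 0" "s \<in> S" for f :: "'a \<Rightarrow> real" and s
  proof -
    have "(\<Sum>s\<in>S. f s ^ (2 * j)) = 0"
      using that by (intro antisym sum_nonneg) auto
    then show ?thesis using that(2) fin by (subst (asm) sum_nonneg_eq_0_iff) auto
  qed
  show ?thesis
  \<comment> \<open>The normalisation below divides by \<open>A\<close> and \<open>B\<close>. A
    vanishing bound forces the corresponding function to vanish on \<open>S\<close>.\<close>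
  proof (cases "A = 0 \<or> B = 0")
    case True
    then have "g s = 0 \<or> h s = 0" if "s \<in> S" for s
      using vanish[of g s] vanish[of h s] that g h i by (auto simp: zero_power)
    then have "g s ^ (2 * i) * h s ^ (2 * (j - i)) = 0" if "s \<in> S" for s
      using that i by (auto simp: zero_power)
    then have "(\<Sum>s\<in>S. g s ^ (2 * i) * h s ^ (2 * (j - i))) = 0"
      by (rule sum.neutral[OF ballI])
    then show ?thesis using assms by simp
  next
    case False
    then have pos: "0 < A" "0 < B" using assms by auto
    let ?\<theta> = "real i / real j"
    have \<theta>: "0 \<le> ?\<theta>" "0 \<le> 1 - ?\<theta>" using i by auto
    \<comment> \<open>After division by \<open>A\<close> and \<open>B\<close> both families of
      squares have \<open>j\<close>-th power sum at most \<open>N\<close>, so the AM-GM bound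
      averages to \<open>N\<close>.\<close>
    have "(\<Sum>s\<in>S. g s ^ (2 * i) * h s ^ (2 * (j - i)))
        = (A ^ i * B ^ (j - i)) * (\<Sum>s\<in>S. ((g s)\<^sup>2 / A) ^ i * ((h s)\<^sup>2 / B) ^ (j - i))"
      using pos by (simp add: sum_distrib_left power_divide power_mult)
    also have "\<dots> \<le> (A ^ i * B ^ (j - i)) *
        (\<Sum>s\<in>S. ?\<theta> * ((g s)\<^sup>2 / A) ^ j + (1 - ?\<theta>) * ((h s)\<^sup>2 / B) ^ j)"
      using pos i by (intro mult_left_mono sum_mono weighted_power_mean) auto
    also have "(\<Sum>s\<in>S. ?\<theta> * ((g s)\<^sup>2 / A) ^ j + (1 - ?\<theta>) * ((h s)\<^sup>2 / B) ^ j)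
        = ?\<theta> * ((\<Sum>s\<in>S. g s ^ (2 * j)) / A ^ j) + (1 - ?\<theta>) * ((\<Sum>s\<in>S. h s ^ (2 * j)) / B ^ j)"
      by (simp add: sum.distrib power_divide power_mult sum_distrib_left sum_divide_distrib)
    also have "\<dots> \<le> ?\<theta> * N + (1 - ?\<theta>) * N"
      using pos g h \<theta> by (intro add_mono mult_left_mono) (auto simp: divide_le_eq)
    also have "\<dots> = N" by (simp add: algebra_simps)
    finally show ?thesis using pos by (simp add: mult.commute)
  qed
qed

lemma sum_Pow_lessThan_Suc:
  fixes F :: "nat set \<Rightarrow> real"
  shows "(\<Sum>T\<in>Pow {..<Suc n}. F T) = (\<Sum>T\<in>Pow {..<n}. F T) + (\<Sum>T\<in>Pow {..<n}. F (insert n T))"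
proof -
  have "Pow {..<n} \<inter> insert n ` Pow {..<n} = {}" by auto
  moreover have "inj_on (insert n) (Pow {..<n})"
    by (rule inj_onI) (metis Diff_insert_absorb PowD in_mono lessThan_iff less_irrefl)
  ultimately show ?thesis
    by (simp add: lessThan_Suc Pow_insert sum.union_disjoint sum.reindex)
qed

text \<open>Bonami's lemma for even exponents, in the weighted form that needs no degree bound.\<close>

lemma hypercontractive_even_moment:
  fixes a :: "nat set \<Rightarrow> real"
  assumes j: "1 \<le> j"
  shows "(\<Sum>\<sigma>\<in>cube n. (\<Sum>T\<in>Pow {..<n}. a T * character T \<sigma>) ^ (2 * j))
    \<le> 2 ^ n * (\<Sum>T\<in>Pow {..<n}. (2 * real j - 1) ^ card T * (a T)\<^sup>2) ^ j"
proof (induction n arbitrary: a)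
  case 0
  have "cube 0 = {[]}" by (auto simp: cube_def)
  then show ?case by (simp add: power_mult)
next
  case (Suc n)
  let ?w = "2 * real j - 1"
  have w: "0 \<le> ?w" using j by simp
  \<comment> \<open>Separating the last coordinate \<open>x\<close> writes the polynomial as
    \<open>h + x * g\<close>.\<close>
  define h where "h \<sigma> = (\<Sum>T\<in>Pow {..<n}. a T * character T \<sigma>)" for \<sigma>
  define g where "g \<sigma> = (\<Sum>T\<in>Pow {..<n}. a (insert n T) * character T \<sigma>)" for \<sigma>
  define B where "B = (\<Sum>T\<in>Pow {..<n}. ?w ^ card T * (a T)\<^sup>2)"
  define A where "A = (\<Sum>T\<in>Pow {..<n}. ?w ^ card T * (a (insert n T))\<^sup>2)"
  have nonneg: "0 \<le> A" "0 \<le> B" unfolding A_def B_def using w by (auto intro!: sum_nonneg)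
  have h: "(\<Sum>\<sigma>\<in>cube n. h \<sigma> ^ (2 * j)) \<le> 2 ^ n * B ^ j"
    unfolding h_def B_def by (rule Suc.IH)
  have g: "(\<Sum>\<sigma>\<in>cube n. g \<sigma> ^ (2 * j)) \<le> 2 ^ n * A ^ j"
    unfolding g_def A_def by (rule Suc.IH)
  have split: "(\<Sum>T\<in>Pow {..<Suc n}. a T * character T (\<sigma> @ [x])) = h \<sigma> + of_int x * g \<sigma>"
    if "\<sigma> \<in> cube n" for \<sigma> x
  proof -
    have len: "length \<sigma> = n" using that by (simp add: cube_def)
    have old: "character T (\<sigma> @ [x]) = character T \<sigma>" if "T \<in> Pow {..<n}" for T
      using that len by (intro prod.cong) (auto simp: nth_append)
    have "character (insert n T) (\<sigma> @ [x]) = of_int x * character T \<sigma>" if "T \<in> Pow {..<n}" for T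
    proof -
      have "finite T" "n \<notin> T" using that finite_subset[of T "{..<n}"] by auto
      then show ?thesis using old[OF that] len by (simp add: nth_append)
    qed
    then show ?thesis
      unfolding sum_Pow_lessThan_Suc h_def g_def
      by (simp add: old sum_distrib_left mult.left_commute)
  qed
  have "(\<Sum>\<sigma>\<in>cube (Suc n). (\<Sum>T\<in>Pow {..<Suc n}. a T * character T \<sigma>) ^ (2 * j))
      = (\<Sum>\<sigma>\<in>cube n. (h \<sigma> + g \<sigma>) ^ (2 * j) + (h \<sigma> - g \<sigma>) ^ (2 * j))"
    unfolding sum_cube_Suc by (rule sum.cong) (auto simp: split)
  also have "\<dots> = 2 * (\<Sum>i\<le>j. real (2 * j choose (2 * i)) *
      (\<Sum>\<sigma>\<in>cube n. g \<sigma> ^ (2 * i) * h \<sigma> ^ (2 * (j - i))))"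
    unfolding sum_even_binomial sum_distrib_left by (rule sum.swap)
  \<comment> \<open>The binomial comparison and Hoelder's inequality with the induction hypotheses
    turn the sum into the expansion of \<open>(?w * A + B) ^ j\<close>. The extra \<open>?w\<close>
    on \<open>A\<close> pays for the element \<open>n\<close> added to each
    \<open>T\<close>.\<close>
  also have "\<dots> \<le> 2 * (\<Sum>i\<le>j. (?w ^ i * real (j choose i)) * (2 ^ n * (A ^ i * B ^ (j - i))))"
    using j nonneg w h g
    by (intro mult_left_mono sum_mono mult_mono binomial_double_le mixed_moment_le)
       (auto simp: finite_cube intro!: sum_nonneg)
  also have "\<dots> = 2 ^ Suc n * (\<Sum>i\<le>j. real (j choose i) * (?w * A) ^ i * B ^ (j - i))"
    by (simp add: sum_distrib_left power_mult_distrib mult_ac)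
  also have "\<dots> = 2 ^ Suc n * (?w * A + B) ^ j"
    by (simp add: binomial_ring)
  also have "?w * A + B = (\<Sum>T\<in>Pow {..<Suc n}. ?w ^ card T * (a T)\<^sup>2)"
  proof -
    have "card (insert n T) = Suc (card T)" if "T \<in> Pow {..<n}" for T
      using that finite_subset[of T "{..<n}"] by (subst card_insert_disjoint) auto
    then show ?thesis
      unfolding sum_Pow_lessThan_Suc A_def B_def
      by (simp add: sum_distrib_left mult.assoc)
  qed
  finally show ?case .
qed

section \<open>Fourier expansion of the planted distribution\<close>

text \<open>The characters are orthogonal: the sum over \<open>S\<close> factors into a product with
  factors \<open>z ! i * y ! i + 1\<close>, and one factor is zero as soon as \<open>z\<close> and
  \<open>y\<close> differ.\<close>

lemma fourier_inversion:
  assumes y: "y \<in> cube k"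
  shows "pmf Q y = (\<Sum>S\<in>Pow {..<k}. fourier_coeff k Q S * character S y)"
proof -
  have orth: "(\<Sum>S\<in>Pow {..<k}. character S z * character S y) = (if z = y then 2 ^ k else 0)"
    if z: "z \<in> cube k" for z
  proof -
    have "(\<Sum>S\<in>Pow {..<k}. character S z * character S y)
        = (\<Prod>i<k. real_of_int (z ! i) * real_of_int (y ! i) + 1)"
      by (simp add: prod_add prod.distrib)
    also have "\<dots> = (if z = y then 2 ^ k else 0)"
    proof (cases "z = y")
      case True
      have "real_of_int (y ! i) * real_of_int (y ! i) + 1 = 2" if "i < k" for i
        using cube_nth[OF y that] by auto
      then show ?thesis using True by simp
    next
      case False
      then obtain i where i: "i < k" "z ! i \<noteq> y ! i"
        using y z nth_equalityI[of z y] by (auto simp: cube_def)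
      then have "real_of_int (z ! i) * real_of_int (y ! i) + 1 = 0"
        using cube_nth[OF y i(1)] cube_nth[OF z i(1)] by auto
      then have "(\<Prod>i<k. real_of_int (z ! i) * real_of_int (y ! i) + 1) = 0"
        using i(1) by (intro prod_zero) auto
      then show ?thesis using False by simp
    qed
    finally show ?thesis .
  qed
  have "(\<Sum>S\<in>Pow {..<k}. fourier_coeff k Q S * character S y)
      = (\<Sum>S\<in>Pow {..<k}. \<Sum>z\<in>cube k. pmf Q z * (character S z * character S y)) / 2 ^ k"
    by (simp add: fourier_coeff_def sum_divide_distrib sum_distrib_right mult.assoc)
  also have "\<dots> = (\<Sum>z\<in>cube k. pmf Q z * (\<Sum>S\<in>Pow {..<k}. character S z * character S y)) / 2 ^ k"
    by (subst sum.swap) (simp add: sum_distrib_left)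
  also have "\<dots> = (\<Sum>z\<in>cube k. if z = y then pmf Q z * 2 ^ k else 0) / 2 ^ k"
    by (intro arg_cong2[where f = "(/)"] sum.cong refl) (simp add: orth)
  also have "\<dots> = pmf Q y"
    using y by (simp add: finite_cube)
  finally show ?thesis by simp
qed

lemma fourier_coeff_empty:
  assumes "set_pmf Q \<subseteq> cube k"
  shows "fourier_coeff k Q {} = 1 / 2 ^ k"
  using sum_pmf_eq_1[OF finite_cube assms] by (simp add: fourier_coeff_def)

lemma abs_fourier_coeff_le:
  assumes "set_pmf Q \<subseteq> cube k" "S \<subseteq> {..<k}"
  shows "2 ^ k * \<bar>fourier_coeff k Q S\<bar> \<le> 1"
proof -
  have "\<bar>character S y\<bar> = 1" if "y \<in> cube k" for y
  proof -
    have "\<bar>real_of_int (y ! i)\<bar> = 1" if "i \<in> S" for i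
    proof -
      have "i < k" using that assms(2) by auto
      then show ?thesis using cube_nth[OF \<open>y \<in> cube k\<close>] by fastforce
    qed
    then show ?thesis by (simp add: abs_prod)
  qed
  then have "\<bar>\<Sum>y\<in>cube k. pmf Q y * character S y\<bar> \<le> (\<Sum>y\<in>cube k. pmf Q y)"
    by (intro order_trans[OF sum_abs] sum_mono) (simp add: abs_mult)
  then show ?thesis
    using sum_pmf_eq_1[OF finite_cube assms(1)] by (simp add: fourier_coeff_def abs_divide)
qed

section \<open>Characters of clause values and the normalising constant\<close>

fun literal_sign :: "literal \<Rightarrow> real" where
  "literal_sign (Pos i) = 1"
| "literal_sign (Neg i) = -1"

lemma abs_literal_sign [simp]: "\<bar>literal_sign l\<bar> = 1"
  by (cases l) auto

abbreviation clause_vars :: "clause \<Rightarrow> nat set \<Rightarrow> nat set" where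
  "clause_vars C S \<equiv> (\<lambda>i. var (C ! i)) ` S"

lemma inj_on_clause_vars:
  assumes "C \<in> clauses k n" "S \<subseteq> {..<k}"
  shows "inj_on (\<lambda>i. var (C ! i)) S"
proof (rule inj_onI)
  fix i j assume ij: "i \<in> S" "j \<in> S" "var (C ! i) = var (C ! j)"
  have "length C = k" "distinct (map var C)" using assms(1) by (auto simp: clauses_def)
  moreover have "i < k" "j < k" using ij assms(2) by auto
  ultimately show "i = j" using ij(3) nth_eq_iff_index_eq[of "map var C" i j] by simp
qed

lemma clause_vars_subset:
  assumes "C \<in> clauses k n" "S \<subseteq> {..<k}"
  shows "clause_vars C S \<subseteq> {..<n}"
proof -
  have "\<forall>l\<in>set C. var l < n" "length C = k" using assms(1) by (auto simp: clauses_def)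
  then show ?thesis using assms(2) nth_mem by blast
qed

text \<open>A clause repeats no variable, so a product over positions can be reindexed by the
  variables occurring there, with the literal signs split off.\<close>

lemma character_clause_value:
  assumes "C \<in> clauses k n" "S \<subseteq> {..<k}"
  shows "character S (clause_value \<sigma> C)
    = (\<Prod>i\<in>S. literal_sign (C ! i)) * character (clause_vars C S) \<sigma>"
proof -
  have lit: "real_of_int (literal_value \<sigma> l) = literal_sign l * real_of_int (\<sigma> ! var l)" for l
    by (cases l) auto
  have len: "length C = k" using assms(1) by (simp add: clauses_def)
  have "character S (clause_value \<sigma> C)
      = (\<Prod>i\<in>S. literal_sign (C ! i) * real_of_int (\<sigma> ! var (C ! i)))"
    using assms(2) len by (intro prod.cong) (auto simp: clause_value_def lit)
  then show ?thesis
    by (simp add: prod.distrib prod.reindex[OF inj_on_clause_vars[OF assms]])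
qed

lemma clause_value_in_cube:
  assumes "C \<in> clauses k n" "\<sigma> \<in> cube n"
  shows "clause_value \<sigma> C \<in> cube k"
proof -
  have "literal_value \<sigma> l \<in> {1, -1}" if "var l < n" for l
    using cube_nth[OF assms(2) that] by (cases l) auto
  then show ?thesis using assms(1) by (auto simp: clause_value_def cube_def clauses_def)
qed

text \<open>Negating the literal at one fixed position of \<open>S\<close> is an involution on
  clauses that reverses the sign of the character.\<close>

lemma sum_character_clause_value:
  assumes "S \<subseteq> {..<k}" "S \<noteq> {}"
  shows "(\<Sum>C\<in>clauses k n. character S (clause_value \<sigma> C)) = 0"
proof -
  define flip where "flip l = (case l of Pos i \<Rightarrow> Neg i | Neg i \<Rightarrow> Pos i)" for l
  have flip: "var (flip l) = var l" "flip (flip l) = l"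
    "literal_value \<sigma> (flip l) = - literal_value \<sigma> l" for l
    by (cases l; simp add: flip_def)+
  obtain i where i: "i \<in> S" "i < k" using assms by auto
  define F where "F C = C[i := flip (C ! i)]" for C
  have FF: "F (F C) = C" for C
    by (cases "i < length C") (simp_all add: F_def flip list_update_beyond)
  have Fin: "F C \<in> clauses k n" if "C \<in> clauses k n" for C
  proof -
    have C: "length C = k" "distinct (map var C)" "\<forall>v\<in>set (map var C). v < n"
      using that by (auto simp: clauses_def)
    have "map var (F C) = map var C"
      using C(1) i(2) by (intro nth_equalityI) (auto simp: F_def nth_list_update flip)
    moreover have "length (F C) = k" using C(1) by (simp add: F_def)
    moreover have "(\<forall>l\<in>set (F C). var l < n) \<longleftrightarrow> (\<forall>v\<in>set (map var (F C)). v < n)" by simp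
    ultimately show ?thesis using C unfolding clauses_def by simp
  qed
  have neg: "character S (clause_value \<sigma> (F C)) = - character S (clause_value \<sigma> C)"
    if "C \<in> clauses k n" for C
  proof -
    have len: "length C = k" using that by (simp add: clauses_def)
    have "finite S" using assms(1) finite_subset by blast
    then have *: "character S y = real_of_int (y ! i) * character (S - {i}) y" for y
      using i(1) by (rule prod.remove)
    have "character (S - {i}) (clause_value \<sigma> (F C)) = character (S - {i}) (clause_value \<sigma> C)"
      using assms(1) len by (intro prod.cong) (auto simp: clause_value_def F_def)
    moreover have "clause_value \<sigma> (F C) ! i = - (clause_value \<sigma> C ! i)"
      using i len by (simp add: clause_value_def F_def flip)
    ultimately show ?thesis by (simp add: *)
  qed
  have "(\<Sum>C\<in>clauses k n. character S (clause_value \<sigma> C))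
      = (\<Sum>C\<in>clauses k n. character S (clause_value \<sigma> (F C)))"
    by (rule sum.reindex_bij_witness[of _ F F]) (auto simp: FF Fin)
  also have "\<dots> = - (\<Sum>C\<in>clauses k n. character S (clause_value \<sigma> C))"
    by (simp add: neg sum_negf)
  finally show ?thesis by simp
qed

text \<open>Only the empty set contributes, so the normaliser is the same for all assignments and
  the planted distribution has density \<open>2 ^ k * pmf Q (clause_value \<sigma> C)\<close>
  against the uniform one.\<close>

lemma planted_normalizer:
  assumes "set_pmf Q \<subseteq> cube k" "\<sigma> \<in> cube n"
  shows "(\<Sum>C\<in>clauses k n. pmf Q (clause_value \<sigma> C)) = real (card (clauses k n)) / 2 ^ k"
proof -
  have "(\<Sum>C\<in>clauses k n. pmf Q (clause_value \<sigma> C))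
      = (\<Sum>C\<in>clauses k n. \<Sum>S\<in>Pow {..<k}. fourier_coeff k Q S * character S (clause_value \<sigma> C))"
    using assms(2) by (intro sum.cong fourier_inversion clause_value_in_cube) auto
  also have "\<dots> = (\<Sum>S\<in>Pow {..<k}. fourier_coeff k Q S *
      (\<Sum>C\<in>clauses k n. character S (clause_value \<sigma> C)))"
    by (subst sum.swap) (simp add: sum_distrib_left)
  also have "\<dots> = (\<Sum>S\<in>{{}}. fourier_coeff k Q S *
      (\<Sum>C\<in>clauses k n. character S (clause_value \<sigma> C)))"
    by (rule sum.mono_neutral_right) (auto simp: sum_character_clause_value)
  finally show ?thesis using fourier_coeff_empty[OF assms(1)] by simp
qed

section \<open>Acceptance probabilities of queries and their Fourier coefficients\<close>

abbreviation query_prob :: "'x pmf \<Rightarrow> 'x query \<Rightarrow> real" where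
  "query_prob D h \<equiv> measure_pmf.expectation D (\<lambda>x. of_bool (h x))"

lemma query_prob_nonneg: "0 \<le> query_prob D h"
  by (intro integral_nonneg_AE) auto

lemma query_prob_le_1: "query_prob D h \<le> 1"
proof -
  have "query_prob D h \<le> measure_pmf.expectation D (\<lambda>_. 1)"
    by (intro integral_mono_AE measure_pmf.integrable_const_bound[where B = 1]) auto
  then show ?thesis by simp
qed

lemma query_prob_not: "query_prob D (\<lambda>x. \<not> h x) = 1 - query_prob D h"
proof -
  have "query_prob D (\<lambda>x. \<not> h x) = measure_pmf.expectation D (\<lambda>x. 1 - of_bool (h x))"
    by (rule Bochner_Integration.integral_cong) auto
  also have "\<dots> = 1 - query_prob D h"
    by (subst Bochner_Integration.integral_diff)
       (auto intro!: measure_pmf.integrable_const_bound[where B = 1])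
  finally show ?thesis .
qed

lemma query_prob_uniform:
  assumes "k \<le> n"
  shows "query_prob (uniform_clauses k n) h
    = real (card {C \<in> clauses k n. h C}) / real (card (clauses k n))"
proof -
  have "(\<Sum>C\<in>clauses k n. of_bool (h C) :: real) = real (card {C \<in> clauses k n. h C})"
    using finite_clauses by (simp add: of_bool_def sum.If_cases Int_def)
  then show ?thesis
    unfolding uniform_clauses_def
    using clauses_nonempty[OF assms] finite_clauses by (simp add: integral_pmf_of_set)
qed

text \<open>Coefficient of the deviation from the uniform acceptance probability, seen as a
  polynomial in the assignment. The set \<open>S = {}\<close> is left out because it produces that
  uniform probability itself.\<close>

definition query_coeff :: "nat \<Rightarrow> nat \<Rightarrow> int list pmf \<Rightarrow> clause query \<Rightarrow> nat set \<Rightarrow> real" where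
  "query_coeff k n Q h T =
     (\<Sum>S\<in>Pow {..<k} - {{}}. \<Sum>C\<in>{C \<in> clauses k n. h C}.
        if clause_vars C S = T
        then 2 ^ k * fourier_coeff k Q S * (\<Prod>i\<in>S. literal_sign (C ! i)) else 0)
     / real (card (clauses k n))"

text \<open>Expand the density against the uniform distribution by Fourier inversion and collect the
  accepted clauses according to their variables at the positions \<open>S\<close>.\<close>

lemma query_prob_planted:
  assumes "k \<le> n" "set_pmf Q \<subseteq> cube k" "\<sigma> \<in> cube n"
  shows "query_prob (planted k n Q \<sigma>) h - query_prob (uniform_clauses k n) h
    = (\<Sum>T\<in>Pow {..<n}. query_coeff k n Q h T * character T \<sigma>)"
proof -
  let ?X = "clauses k n" and ?H = "{C \<in> clauses k n. h C}"
  let ?N = "real (card ?X)"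
  let ?c = "\<lambda>S C. 2 ^ k * fourier_coeff k Q S * (\<Prod>i\<in>S. literal_sign (C ! i))"
  have N: "?N > 0" using clauses_nonempty[OF assms(1)] finite_clauses by (simp add: card_gt_0_iff)
  have "query_prob (planted k n Q \<sigma>) h = (\<Sum>C\<in>?H. of_bool (h C) * pmf (planted k n Q \<sigma>) C)"
    using finite_clauses
    by (intro integral_measure_pmf_real)
       (auto simp: set_pmf_iff pmf_planted[OF assms(1,3,2)] planted_mass_def split: if_splits)
  also have "\<dots> = (\<Sum>C\<in>?H. 2 ^ k * pmf Q (clause_value \<sigma> C)) / ?N"
    unfolding sum_divide_distrib
    by (rule sum.cong)
       (auto simp: pmf_planted[OF assms(1,3,2)] planted_mass_def planted_normalizer[OF assms(2,3)])
  also have "(\<Sum>C\<in>?H. 2 ^ k * pmf Q (clause_value \<sigma> C))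
      = (\<Sum>C\<in>?H. 1 + (\<Sum>S\<in>Pow {..<k} - {{}}. ?c S C * character (clause_vars C S) \<sigma>))"
  proof (rule sum.cong)
    fix C assume "C \<in> ?H"
    then have C: "C \<in> clauses k n" by simp
    have "2 ^ k * pmf Q (clause_value \<sigma> C)
        = (\<Sum>S\<in>Pow {..<k}. 2 ^ k * fourier_coeff k Q S * character S (clause_value \<sigma> C))"
      using fourier_inversion[OF clause_value_in_cube[OF C assms(3)], of Q]
      by (simp add: sum_distrib_left mult.assoc)
    also have "\<dots> = 2 ^ k * fourier_coeff k Q {} * character {} (clause_value \<sigma> C)
        + (\<Sum>S\<in>Pow {..<k} - {{}}. 2 ^ k * fourier_coeff k Q S * character S (clause_value \<sigma> C))"
      by (rule sum.remove) auto
    also have "\<dots> = 1 + (\<Sum>S\<in>Pow {..<k} - {{}}. ?c S C * character (clause_vars C S) \<sigma>)"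
      using fourier_coeff_empty[OF assms(2)]
      by (auto intro!: sum.cong simp: character_clause_value[OF C])
    finally show "2 ^ k * pmf Q (clause_value \<sigma> C)
      = 1 + (\<Sum>S\<in>Pow {..<k} - {{}}. ?c S C * character (clause_vars C S) \<sigma>)" .
  qed simp
  also have "\<dots> = real (card ?H)
      + (\<Sum>C\<in>?H. \<Sum>S\<in>Pow {..<k} - {{}}. ?c S C * character (clause_vars C S) \<sigma>)"
    by (simp add: sum.distrib)
  \<comment> \<open>Each pair of a clause and a set \<open>S\<close> determines exactly one
    \<open>T\<close>, so a sum over \<open>T\<close> can be inserted.\<close>
  also have "(\<Sum>C\<in>?H. \<Sum>S\<in>Pow {..<k} - {{}}. ?c S C * character (clause_vars C S) \<sigma>)
      = (\<Sum>C\<in>?H. \<Sum>S\<in>Pow {..<k} - {{}}. \<Sum>T\<in>Pow {..<n}.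
          (if clause_vars C S = T then ?c S C else 0) * character T \<sigma>)"
  proof (intro sum.cong refl)
    fix C S assume "C \<in> ?H" "S \<in> Pow {..<k} - {{}}"
    then have "clause_vars C S \<in> Pow {..<n}" using clause_vars_subset[of C k n S] by blast
    then show "?c S C * character (clause_vars C S) \<sigma>
      = (\<Sum>T\<in>Pow {..<n}. (if clause_vars C S = T then ?c S C else 0) * character T \<sigma>)"
      by (simp add: if_distrib[where f = "\<lambda>x. x * _"] cong: if_cong)
  qed
  also have "\<dots> = (\<Sum>S\<in>Pow {..<k} - {{}}. \<Sum>T\<in>Pow {..<n}. \<Sum>C\<in>?H.
          (if clause_vars C S = T then ?c S C else 0) * character T \<sigma>)"
    by (subst sum.swap) (intro sum.cong refl sum.swap)
  also have "\<dots> = (\<Sum>T\<in>Pow {..<n}. \<Sum>S\<in>Pow {..<k} - {{}}. \<Sum>C\<in>?H.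
          (if clause_vars C S = T then ?c S C else 0) * character T \<sigma>)"
    by (rule sum.swap)
  also have "\<dots> = ?N * (\<Sum>T\<in>Pow {..<n}. query_coeff k n Q h T * character T \<sigma>)"
    using N unfolding query_coeff_def sum_distrib_left
    by (intro sum.cong refl) (simp add: sum_distrib_right)
  finally show ?thesis
    using N unfolding query_prob_uniform[OF assms(1)] by (simp add: add_divide_distrib)
qed

text \<open>Renaming variables shows that all variable sets of the same size are equally likely.\<close>

lemma card_clauses_with_vars_le:
  assumes "1 \<le> k" "k \<le> n" "S \<subseteq> {..<k}" "T \<subseteq> {..<n}"
  shows "real (card {C \<in> clauses k n. clause_vars C S = T})
    \<le> real (card (clauses k n)) * (real k / real n) ^ card T"
proof (cases "\<exists>C\<in>clauses k n. clause_vars C S = T")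
  case False
  then have "{C \<in> clauses k n. clause_vars C S = T} = {}" by blast
  then show ?thesis by (simp only: card.empty) simp
next
  case True
  let ?X = "clauses k n" and ?l = "card T"
  let ?N = "\<lambda>T. card {C \<in> clauses k n. clause_vars C S = T}"
  define \<T> where "\<T> = {T'. T' \<subseteq> {..<n} \<and> card T' = ?l}"
  have cardT: "?l = card S"
    using True inj_on_clause_vars[OF _ assms(3)] card_image by blast
  have le: "?l \<le> k" using cardT card_mono[OF _ assms(3)] by simp
  have finT: "finite T" using assms(4) finite_subset by blast
  \<comment> \<open>One inequality suffices for the averaging below: it makes the class of
    \<open>T\<close> at most of average size.\<close>
  have mono: "?N T \<le> ?N T'" if "T' \<in> \<T>" for T'
  proof -
    have T': "T' \<subseteq> {..<n}" "card T' = ?l" using that by (auto simp: \<T>_def)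
    then have finT': "finite T'" using finite_subset by blast
    obtain f where f: "bij_betw f T T'"
      using finite_same_card_bij[OF finT finT'] T'(2) by auto
    have "card ({..<n} - T) = card ({..<n} - T')"
      using T' assms(4) finT finT' by (simp add: card_Diff_subset)
    then obtain g where g: "bij_betw g ({..<n} - T) ({..<n} - T')"
      using finite_same_card_bij[of "{..<n} - T" "{..<n} - T'"] by auto
    \<comment> \<open>Matching the complements as well extends \<open>f\<close> to a permutation of
      all variables, and renaming by it is injective on clauses.\<close>
    define \<pi> where "\<pi> x = (if x \<in> T then f x else g x)" for x
    have "bij_betw \<pi> T T'"
      using f by (subst bij_betw_cong[of T \<pi> f]) (auto simp: \<pi>_def)
    moreover have "bij_betw \<pi> ({..<n} - T) ({..<n} - T')"
      using g by (subst bij_betw_cong[of "{..<n} - T" \<pi> g]) (auto simp: \<pi>_def)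
    ultimately have "bij_betw \<pi> (T \<union> ({..<n} - T)) (T' \<union> ({..<n} - T'))"
      by (rule bij_betw_combine) auto
    moreover have "T \<union> ({..<n} - T) = {..<n}" "T' \<union> ({..<n} - T') = {..<n}"
      using T' assms(4) by auto
    ultimately have \<pi>: "inj_on \<pi> {..<n}" "\<pi> ` {..<n} = {..<n}" "\<pi> ` T = T'"
      using \<open>bij_betw \<pi> T T'\<close> by (auto simp: bij_betw_def)
    define \<rho> where "\<rho> l = (case l of Pos i \<Rightarrow> Pos (\<pi> i) | Neg i \<Rightarrow> Neg (\<pi> i))" for l
    have var\<rho>: "var (\<rho> l) = \<pi> (var l)" for l by (cases l) (auto simp: \<rho>_def)
    have inj\<rho>: "inj_on \<rho> {l. var l < n}"
    proof (rule inj_onI)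
      fix l l' assume "l \<in> {l. var l < n}" "l' \<in> {l. var l < n}" "\<rho> l = \<rho> l'"
      then show "l = l'"
        using \<pi>(1) by (cases l; cases l') (auto simp: \<rho>_def inj_on_def)
    qed
    show ?thesis
    proof (rule card_inj_on_le[where f = "map \<rho>"])
      show "inj_on (map \<rho>) {C \<in> clauses k n. clause_vars C S = T}"
        by (rule inj_on_mapI, rule inj_on_subset[OF inj\<rho>]) (auto simp: clauses_def)
      show "map \<rho> ` {C \<in> clauses k n. clause_vars C S = T} \<subseteq> {C \<in> clauses k n. clause_vars C S = T'}"
      proof (rule image_subsetI)
        fix C assume "C \<in> {C \<in> clauses k n. clause_vars C S = T}"
        then have C: "length C = k" "distinct (map var C)" "\<forall>l\<in>set C. var l < n"
          "clause_vars C S = T"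
          by (auto simp: clauses_def)
        have "map var (map \<rho> C) = map \<pi> (map var C)" by (simp add: var\<rho>)
        moreover have "inj_on \<pi> (set (map var C))" using \<pi>(1) C(3) by (auto intro: inj_on_subset)
        ultimately have "distinct (map var (map \<rho> C))" using C(2) by (simp only: distinct_map)
        moreover have "var l < n" if "l \<in> set (map \<rho> C)" for l
          using that C(3) \<pi>(2) by (auto simp: var\<rho>)
        moreover have "clause_vars (map \<rho> C) S = \<pi> ` clause_vars C S"
          using C(1) assms(3) unfolding image_image
          by (intro image_cong) (auto simp: var\<rho>)
        ultimately show "map \<rho> C \<in> {C \<in> clauses k n. clause_vars C S = T'}"
          using C(1,4) \<pi>(3) by (simp add: clauses_def)
      qed
    qed (simp add: finite_clauses)
  qed
  have fin: "finite \<T>" by (auto simp: \<T>_def)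
  have "(n choose ?l) * ?N T = (\<Sum>T'\<in>\<T>. ?N T)"
    using n_subsets[of "{..<n}" ?l] by (simp add: \<T>_def)
  also have "\<dots> \<le> (\<Sum>T'\<in>\<T>. ?N T')" by (rule sum_mono) (rule mono)
  also have "\<dots> = card (\<Union>T'\<in>\<T>. {C \<in> clauses k n. clause_vars C S = T'})"
    using fin finite_clauses by (intro card_UN_disjoint[symmetric]) auto
  also have "\<dots> \<le> card ?X" by (rule card_mono) (auto simp: finite_clauses)
  finally have "real (n choose ?l) * real (?N T) \<le> real (card ?X)"
    by (simp flip: of_nat_mult)
  moreover have "(real n / real k) ^ ?l \<le> real (n choose ?l)"
  proof (cases "?l = 0")
    case False
    then have "(real n / real k) ^ ?l \<le> (real n / real ?l) ^ ?l"
      using le by (intro power_mono divide_left_mono) auto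
    also have "\<dots> \<le> real (n choose ?l)"
      using le assms(2) by (intro binomial_ge_n_over_k_pow_k) auto
    finally show ?thesis .
  qed simp
  ultimately have "(real n / real k) ^ ?l * real (?N T) \<le> real (card ?X)"
    by (meson mult_right_mono of_nat_0_le_iff order_trans)
  then show ?thesis using assms(1,2) by (simp add: power_divide field_simps)
qed

text \<open>For a majorant \<open>b\<close> of the coefficients, split
  \<open>w ^ card T * (b T)^2\<close> as \<open>(w ^ card T * b T) * b T\<close>. The first factor
  is uniformly small by the spread of the variable sets, and the second sums to a multiple of the
  acceptance probability. Each of them costs \<open>2 ^ k\<close> for the number of sets
  \<open>S\<close>. As \<open>w * k / n\<close> is at most one, the lowest degree \<open>r\<close>
  dominates.\<close>

lemma query_coeff_weighted_sum_le:
  assumes "1 \<le> k" "k \<le> n" "set_pmf Q \<subseteq> cube k" and r: "has_distribution_complexity k Q r"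
    and w: "0 \<le> w" "w * real k \<le> real n"
  shows "(\<Sum>T\<in>Pow {..<n}. w ^ card T * (query_coeff k n Q h T)\<^sup>2)
    \<le> 4 ^ k * query_prob (uniform_clauses k n) h * (w * real k / real n) ^ r"
proof -
  let ?X = "clauses k n" and ?H = "{C \<in> clauses k n. h C}"
  let ?N = "real (card ?X)" and ?x = "w * real k / real n"
  define \<S> where "\<S> = {S. S \<subseteq> {..<k} \<and> r \<le> card S}"
  \<comment> \<open>Triangle-inequality majorant of the coefficient: non-empty sets outside
    \<open>\<S>\<close> have zero Fourier coefficient, and the others satisfy
    \<open>2 ^ k * \<bar>fourier_coeff k Q S\<bar> \<le> 1\<close>.\<close>
  define b where "b T = (\<Sum>S\<in>\<S>. real (card {C \<in> ?H. clause_vars C S = T})) / ?N" for T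
  have N: "?N > 0" using clauses_nonempty[OF assms(2)] finite_clauses by (simp add: card_gt_0_iff)
  have "card \<S> \<le> 2 ^ k"
    using card_mono[of "Pow {..<k}" \<S>] by (auto simp: card_Pow \<S>_def)
  then have card\<S>: "real (card \<S>) \<le> 2 ^ k"
    by (metis of_nat_le_iff of_nat_numeral of_nat_power)
  have x: "0 \<le> ?x" "?x \<le> 1" using w assms(1,2) by (auto simp: divide_le_eq)
  have b0: "0 \<le> b T" for T unfolding b_def by (auto intro!: divide_nonneg_nonneg sum_nonneg)
  have coeff: "\<bar>query_coeff k n Q h T\<bar> \<le> b T" for T
  proof -
    have "\<bar>\<Sum>S\<in>Pow {..<k} - {{}}. \<Sum>C\<in>?H. if clause_vars C S = T
          then 2 ^ k * fourier_coeff k Q S * (\<Prod>i\<in>S. literal_sign (C ! i)) else 0\<bar>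
        \<le> (\<Sum>S\<in>Pow {..<k} - {{}}. \<Sum>C\<in>?H.
            if S \<in> \<S> then of_bool (clause_vars C S = T) else 0)"
    proof (intro order_trans[OF sum_abs] sum_mono)
      fix S C assume S: "S \<in> Pow {..<k} - {{}}"
      then have "1 \<le> card S" using finite_subset[of S "{..<k}"] by (simp add: Suc_le_eq card_gt_0_iff)
      then have "S \<notin> \<S> \<Longrightarrow> fourier_coeff k Q S = 0"
        using r S unfolding has_distribution_complexity_def \<S>_def by blast
      then show "\<bar>if clause_vars C S = T
          then 2 ^ k * fourier_coeff k Q S * (\<Prod>i\<in>S. literal_sign (C ! i)) else 0\<bar>
        \<le> (if S \<in> \<S> then of_bool (clause_vars C S = T) else 0)"
        using abs_fourier_coeff_le[OF assms(3), of S] S by (auto simp: abs_mult abs_prod)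
    qed
    also have "\<dots> = (\<Sum>S\<in>Pow {..<k} - {{}}. if S \<in> \<S>
        then real (card {C \<in> ?H. clause_vars C S = T}) else 0)"
      by (rule sum.cong) (simp_all add: finite_clauses of_bool_def sum.If_cases Int_def)
    also have "\<dots> = (\<Sum>S\<in>\<S>. real (card {C \<in> ?H. clause_vars C S = T}))"
    proof (rule sum.mono_neutral_cong_right)
      have "1 \<le> r" using r by (simp add: has_distribution_complexity_def)
      then show "\<S> \<subseteq> Pow {..<k} - {{}}" by (auto simp: \<S>_def)
    qed auto
    finally show ?thesis
      unfolding query_coeff_def b_def by (simp add: divide_right_mono abs_divide)
  qed
  have sum_b: "(\<Sum>T\<in>Pow {..<n}. b T) \<le> 2 ^ k * query_prob (uniform_clauses k n) h"
  proof -
    have "(\<Sum>T\<in>Pow {..<n}. real (card {C \<in> ?H. clause_vars C S = T})) \<le> real (card ?H)" for S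
    proof -
      have "(\<Sum>T\<in>Pow {..<n}. card {C \<in> ?H. clause_vars C S = T})
          = card (\<Union>T\<in>Pow {..<n}. {C \<in> ?H. clause_vars C S = T})"
        using finite_clauses by (intro card_UN_disjoint[symmetric]) auto
      also have "\<dots> \<le> card ?H" by (rule card_mono) (auto simp: finite_clauses)
      finally show ?thesis by (simp flip: of_nat_sum)
    qed
    then have "(\<Sum>S\<in>\<S>. \<Sum>T\<in>Pow {..<n}. real (card {C \<in> ?H. clause_vars C S = T}))
        \<le> real (card \<S>) * real (card ?H)"
      by (intro sum_bounded_above)
    also have "\<dots> \<le> 2 ^ k * real (card ?H)"
      using card\<S> by (intro mult_right_mono) auto
    finally have "(\<Sum>T\<in>Pow {..<n}. b T) \<le> 2 ^ k * real (card ?H) / ?N"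
      unfolding b_def sum_divide_distrib[symmetric]
      by (subst sum.swap) (simp add: divide_right_mono)
    then show ?thesis by (simp add: query_prob_uniform[OF assms(2)])
  qed
  have weight: "w ^ card T * b T \<le> 2 ^ k * ?x ^ r" if T: "T \<in> Pow {..<n}" for T
  proof (cases "\<exists>S\<in>\<S>. \<exists>C\<in>?X. clause_vars C S = T")
    case False
    then have "card {C \<in> ?H. clause_vars C S = T} = 0" if "S \<in> \<S>" for S
      using that by (subst card_eq_0_iff) blast
    then have "b T = 0" unfolding b_def by simp
    then show ?thesis using x(1) by simp
  next
    case True
    then obtain S C where SC: "S \<in> \<S>" "C \<in> ?X" "clause_vars C S = T" by blast
    then have "card T = card S"
      using card_image[OF inj_on_clause_vars[of C k n S]] by (auto simp: \<S>_def)
    then have rT: "r \<le> card T" using SC(1) by (simp add: \<S>_def)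
    have "b T \<le> (\<Sum>S\<in>\<S>. ?N * (real k / real n) ^ card T) / ?N"
      unfolding b_def
    proof (intro divide_right_mono sum_mono)
      fix S assume "S \<in> \<S>"
      then have S: "S \<subseteq> {..<k}" by (simp add: \<S>_def)
      have "card {C \<in> ?H. clause_vars C S = T} \<le> card {C \<in> ?X. clause_vars C S = T}"
        by (rule card_mono) (auto simp: finite_clauses)
      then show "real (card {C \<in> ?H. clause_vars C S = T}) \<le> ?N * (real k / real n) ^ card T"
        using card_clauses_with_vars_le[OF assms(1,2) S, of T] T by simp
    qed simp
    also have "\<dots> = real (card \<S>) * (real k / real n) ^ card T" using N by simp
    also have "\<dots> \<le> 2 ^ k * (real k / real n) ^ card T"
      using card\<S> by (intro mult_right_mono) auto
    finally have "w ^ card T * b T \<le> w ^ card T * (2 ^ k * (real k / real n) ^ card T)"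
      using w(1) by (intro mult_left_mono) auto
    also have "\<dots> = 2 ^ k * ?x ^ card T" by (simp add: power_divide power_mult_distrib)
    also have "\<dots> \<le> 2 ^ k * ?x ^ r"
      using x rT by (intro mult_left_mono power_decreasing) auto
    finally show ?thesis .
  qed
  have "(\<Sum>T\<in>Pow {..<n}. w ^ card T * (query_coeff k n Q h T)\<^sup>2)
      \<le> (\<Sum>T\<in>Pow {..<n}. (2 ^ k * ?x ^ r) * b T)"
  proof (rule sum_mono)
    fix T assume T: "T \<in> Pow {..<n}"
    have "(query_coeff k n Q h T)\<^sup>2 \<le> (b T)\<^sup>2"
      using coeff[of T] b0[of T] by (simp add: abs_le_square_iff[symmetric])
    then have "w ^ card T * (query_coeff k n Q h T)\<^sup>2 \<le> w ^ card T * (b T)\<^sup>2"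
      using w(1) by (intro mult_left_mono) auto
    also have "\<dots> = (w ^ card T * b T) * b T" by (simp add: power2_eq_square)
    also have "\<dots> \<le> (2 ^ k * ?x ^ r) * b T"
      by (rule mult_right_mono[OF weight[OF T] b0])
    finally show "w ^ card T * (query_coeff k n Q h T)\<^sup>2 \<le> (2 ^ k * ?x ^ r) * b T" .
  qed
  also have "\<dots> \<le> (2 ^ k * ?x ^ r) * (2 ^ k * query_prob (uniform_clauses k n) h)"
    unfolding sum_distrib_left[symmetric] using x(1) by (intro mult_left_mono sum_b) auto
  also have "\<dots> = 4 ^ k * query_prob (uniform_clauses k n) h * ?x ^ r"
    by (simp add: power_mult_distrib[symmetric])
  finally show ?thesis .
qed

text \<open>Bonami's lemma with weight \<open>w = 2 * j - 1\<close>, combined with the weighted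
  coefficient bound, whose condition \<open>w * k \<le> n\<close> limits the usable moments.\<close>

lemma query_deviation_moment:
  assumes "1 \<le> k" "k \<le> n" "set_pmf Q \<subseteq> cube k" "has_distribution_complexity k Q r"
    and "1 \<le> j" "(2 * real j - 1) * real k \<le> real n"
  shows "(\<Sum>\<sigma>\<in>cube n. (query_prob (planted k n Q \<sigma>) h - query_prob (uniform_clauses k n) h) ^ (2 * j))
    \<le> 2 ^ n * (4 ^ k * query_prob (uniform_clauses k n) h
                 * ((2 * real j - 1) * real k / real n) ^ r) ^ j"
proof -
  have "(\<Sum>\<sigma>\<in>cube n. (query_prob (planted k n Q \<sigma>) h - query_prob (uniform_clauses k n) h) ^ (2 * j))
      = (\<Sum>\<sigma>\<in>cube n. (\<Sum>T\<in>Pow {..<n}. query_coeff k n Q h T * character T \<sigma>) ^ (2 * j))"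
    using assms(2,3) by (intro sum.cong) (auto simp: query_prob_planted)
  also have "\<dots> \<le> 2 ^ n * (\<Sum>T\<in>Pow {..<n}.
      (2 * real j - 1) ^ card T * (query_coeff k n Q h T)\<^sup>2) ^ j"
    by (rule hypercontractive_even_moment[OF assms(5)])
  also have "\<dots> \<le> 2 ^ n * (4 ^ k * query_prob (uniform_clauses k n) h
                 * ((2 * real j - 1) * real k / real n) ^ r) ^ j"
    using assms by (intro mult_left_mono power_mono query_coeff_weighted_sum_le sum_nonneg) auto
  finally show ?thesis .
qed

section \<open>Runs against similar oracles\<close>

lemma integrable_measure_pmf_bounded:
  fixes f :: "'a \<Rightarrow> real"
  assumes "\<And>x. \<bar>f x\<bar> \<le> B"
  shows "integrable (measure_pmf p) f"
  using assms by (intro measure_pmf.integrable_const_bound[where B = B]) auto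

text \<open>In the uniform case a correct answer excludes the output \<open>Some True\<close>, and
  running out of calls counts as failure. A success probability of \<open>2 / 3\<close> therefore
  gives an average advantage of at least \<open>1 / 3\<close> in accepting planted
  instances.\<close>

lemma success_prob_le:
  "2 ^ n * (2 * success_prob k n Q m A orc - 1)
     \<le> (\<Sum>\<sigma>\<in>cube n. pmf (run m A (orc (planted k n Q \<sigma>)) []) (Some True))
       - 2 ^ n * pmf (run m A (orc (uniform_clauses k n)) []) (Some True)"
proof -
  let ?g = "\<lambda>D b. pmf (run m A (orc D) []) (Some b)" and ?U = "uniform_clauses k n"
  have eq: "(\<lambda>out. out = Some b) -` {True} = {Some b}" for b :: bool by auto
  have [simp]: "pmf (map_pmf (\<lambda>out. out = Some b) M) True = pmf M (Some b)" for M and b :: bool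
    unfolding pmf_map eq by (simp add: measure_pmf_single)
  have "success_prob k n Q m A orc
      = (\<Sum>\<sigma>\<in>cube n. ?g (planted k n Q \<sigma>) True) / 2 ^ n / 2 + ?g ?U False / 2"
    unfolding success_prob_def random_instance_def bind_assoc_pmf
    by (simp add: pmf_bind bind_map_pmf bind_return_pmf integral_pmf_of_set finite_cube
        cube_nonempty card_cube)
  moreover have "?g ?U True + ?g ?U False \<le> 1"
    using measure_measure_pmf_finite[of "{Some True, Some False}" "run m A (orc ?U) []"]
      measure_pmf.prob_le_1[of "run m A (orc ?U) []" "{Some True, Some False}"] by simp
  then have "2 ^ n * (?g ?U True + ?g ?U False) \<le> 2 ^ n * 1" by (intro mult_left_mono) auto
  ultimately show ?thesis by (simp add: field_simps)
qed

lemma pmf_run_0: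
  "pmf (run 0 A orc H) (Some b) =
     measure_pmf.expectation (A H)
       (\<lambda>move. case move of Inl q \<Rightarrow> 0 | Inr b' \<Rightarrow> of_bool (b' = b))"
  unfolding run.simps pmf_bind
  by (rule Bochner_Integration.integral_cong) (auto split: sum.split)

lemma pmf_run_Suc:
  "pmf (run (Suc m) A orc H) (Some b) =
     measure_pmf.expectation (A H)
       (\<lambda>move. case move of
          Inl q \<Rightarrow> measure_pmf.expectation (orc H q) (\<lambda>a. pmf (run m A orc (H @ [(q, a)])) (Some b))
        | Inr b' \<Rightarrow> of_bool (b' = b))"
  unfolding run.simps pmf_bind
  by (rule Bochner_Integration.integral_cong) (auto split: sum.split simp: pmf_bind)

text \<open>
  Every query separates few of the sources from the reference source, so a run against a random
  source mostly stays on the transcript of the run against the reference source.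
\<close>

lemma sum_run_deterministic_le:
  fixes v :: "'s \<Rightarrow> ('q, 'a) transcript \<Rightarrow> 'q \<Rightarrow> 'a"
  assumes fin: "finite \<Sigma>" and P: "\<And>H q. real (card {s \<in> \<Sigma>. v s H q \<noteq> v0 H q}) \<le> P"
  shows "(\<Sum>s\<in>\<Sigma>. pmf (run m A (\<lambda>H q. return_pmf (v s H q)) H) (Some b))
    \<le> real (card \<Sigma>) * pmf (run m A (\<lambda>H q. return_pmf (v0 H q)) H) (Some b) + real m * P"
proof (induction m arbitrary: H)
  case 0
  then show ?case by (simp add: pmf_run_0)
next
  case (Suc m)
  let ?N = "real (card \<Sigma>)"
  define g where "g m s H = pmf (run m A (\<lambda>H q. return_pmf (v s H q)) H) (Some b)" for m s H
  define g0 where "g0 m H = pmf (run m A (\<lambda>H q. return_pmf (v0 H q)) H) (Some b)" for m H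
  define f where "f s move = (case move of Inl q \<Rightarrow> g m s (H @ [(q, v s H q)])
    | Inr b' \<Rightarrow> of_bool (b' = b))" for s move
  define f0 where "f0 move = (case move of Inl q \<Rightarrow> g0 m (H @ [(q, v0 H q)])
    | Inr b' \<Rightarrow> of_bool (b' = b))" for move
  have g01: "0 \<le> g m s H" "g m s H \<le> 1" "0 \<le> g0 m H" "g0 m H \<le> 1" for m s H
    by (auto simp: g_def g0_def pmf_le_1)
  have P0: "0 \<le> P" using order_trans[OF of_nat_0_le_iff P] .
  have g_Suc: "g (Suc m) s H = measure_pmf.expectation (A H) (f s)" for s
    unfolding g_def pmf_run_Suc f_def by (simp add: g_def)
  have g0_Suc: "g0 (Suc m) H = measure_pmf.expectation (A H) f0"
    unfolding g0_def pmf_run_Suc f0_def by (simp add: g0_def)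
  have int: "integrable (A H) (f s)" "integrable (A H) f0" for s
    by (auto intro!: integrable_measure_pmf_bounded[where B = 1] split: sum.split
        simp: f_def f0_def g01 abs_of_nonneg)
  have "(\<Sum>s\<in>\<Sigma>. f s move) \<le> ?N * f0 move + real (Suc m) * P" for move
  proof (cases move)
    case (Inl q)
    let ?bad = "{s \<in> \<Sigma>. v s H q \<noteq> v0 H q}" and ?H = "H @ [(q, v0 H q)]"
    \<comment> \<open>A source that answers as the reference does stays on the same transcript; each
      other source is charged the trivial bound \<open>1\<close>.\<close>
    have "(\<Sum>s\<in>\<Sigma>. f s move) \<le> (\<Sum>s\<in>\<Sigma>. g m s ?H + of_bool (v s H q \<noteq> v0 H q))"
      using g01 by (intro sum_mono) (auto simp: Inl f_def add_increasing)
    also have "\<dots> = (\<Sum>s\<in>\<Sigma>. g m s ?H) + real (card ?bad)"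
      using fin by (simp add: sum.distrib of_bool_def sum.If_cases Int_def)
    also have "\<dots> \<le> (?N * g0 m ?H + real m * P) + P"
      using Suc.IH[of ?H] P[of H q] unfolding g_def g0_def by (intro add_mono)
    finally show ?thesis by (simp add: Inl f0_def algebra_simps)
  next
    case (Inr b')
    then show ?thesis using P0 by (simp add: f_def f0_def)
  qed
  then have "measure_pmf.expectation (A H) (\<lambda>move. \<Sum>s\<in>\<Sigma>. f s move)
      \<le> measure_pmf.expectation (A H) (\<lambda>move. ?N * f0 move + real (Suc m) * P)"
    using int by (intro integral_mono) auto
  then show ?case
    using int unfolding g_def[symmetric] g0_def[symmetric] g_Suc g0_Suc by simp
qed

section \<open>Potential argument for 1-STAT runs\<close>

text \<open>
  The numerator of the first summand is the triangular discrimination \<open>(u - s)\<^sup>2 / (u + s)\<close> of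
  two masses; the second summand makes the total dominate \<open>s - u\<close> by AM-GM.
\<close>

definition potential :: "real \<Rightarrow> real \<Rightarrow> real \<Rightarrow> real" where
  "potential \<eta> u s = (s - 3 * u + 4 * u\<^sup>2 / (u + s)) / (2 * \<eta>) + \<eta> * (u + s) / 2"

text \<open>With \<open>D = u + s\<close> and \<open>X = s - u\<close> the potential is
  \<open>X^2 / (2 \<eta> D) + \<eta> D / 2\<close>, and its excess over \<open>X\<close> is a
  perfect square divided by \<open>2 \<eta> D\<close>.\<close>

lemma potential_ge:
  assumes "0 < \<eta>" "0 \<le> u" "0 \<le> s"
  shows "s - u \<le> potential \<eta> u s" "0 \<le> potential \<eta> u s"
proof -
  have "s - u \<le> potential \<eta> u s \<and> 0 \<le> potential \<eta> u s"
  proof (cases "u + s = 0")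
    case True
    then have "u = 0" "s = 0" using assms by auto
    then show ?thesis by (simp add: potential_def)
  next
    case False
    define D X where "D = u + s" and "X = s - u"
    have D: "0 < D" using False assms by (simp add: D_def)
    have "s - 3 * u + 4 * u\<^sup>2 / D = X\<^sup>2 / D"
      using D unfolding D_def X_def by (simp add: field_simps power2_eq_square)
    then have pot: "potential \<eta> u s = X\<^sup>2 / D / (2 * \<eta>) + \<eta> * D / 2"
      unfolding potential_def D_def by simp
    moreover have "X\<^sup>2 / D / (2 * \<eta>) + \<eta> * D / 2 - X = (X - \<eta> * D)\<^sup>2 / (2 * \<eta> * D)"
      using D assms(1) by (simp add: field_simps power2_eq_square)
    moreover have "0 \<le> (X - \<eta> * D)\<^sup>2 / (2 * \<eta> * D)" "0 \<le> X\<^sup>2 / D / (2 * \<eta>) + \<eta> * D / 2"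
      using D assms(1) by auto
    ultimately show ?thesis unfolding X_def by linarith
  qed
  then show "s - u \<le> potential \<eta> u s" "0 \<le> potential \<eta> u s" by auto
qed

text \<open>First-order Taylor expansion in \<open>b\<close> at \<open>b = a\<close>, where
  homogeneity gives \<open>a * potential \<eta> u s\<close>. The linear term cancels when both
  answers of a query are added. The remainder carries the weight \<open>u\<close> but not
  \<open>s\<close>, so the chi-square bound alone controls its sum over the sources. The premise
  \<open>ab\<close> is absolute continuity: at \<open>a = 0\<close> the remainder term is zero by
  the convention for division.\<close>

lemma potential_step:
  assumes l: "0 < \<eta>" and u: "0 \<le> u" and s: "0 \<le> s" and a: "0 \<le> a" and b: "0 \<le> b"
    and ab: "a = 0 \<Longrightarrow> b = 0"
  shows "potential \<eta> (u * a) (s * b) \<le> a * potential \<eta> u s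
    + (s * (1 - 4 * u\<^sup>2 / (u + s)\<^sup>2) / (2 * \<eta>) + \<eta> * s / 2) * (b - a)
    + 2 / \<eta> * (u * ((b - a)\<^sup>2 / a))"
proof (cases "a = 0 \<or> u = 0")
  case True
  then show ?thesis
  proof
    assume "a = 0"
    then show ?thesis using ab by (simp add: potential_def)
  next
    assume "u = 0"
    then show ?thesis using l by (simp add: potential_def field_simps)
  qed
next
  case False
  then have pos: "0 < a" "0 < u" using a u by auto
  define D where "D = u + s"
  define d where "d = s * (b - a)"
  define E where "E = u * a + s * b"
  have D: "0 < D" using pos s by (simp add: D_def)
  have E: "E = a * D + d" by (simp add: E_def D_def d_def algebra_simps)
  have ua: "u * a \<le> E" "0 < u * a" using pos s b by (auto simp: E_def)
  then have Epos: "0 < E" by linarith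
  \<comment> \<open>As \<open>E = a * D + d\<close>, this is the exact remainder of expanding
    \<open>a^2 / E\<close> to first order in \<open>d\<close>.\<close>
  have id: "a\<^sup>2 / E - a / D + d / D\<^sup>2 = d\<^sup>2 / (D\<^sup>2 * E)"
  proof -
    have "a\<^sup>2 / E - a / D + d / D\<^sup>2 = (a\<^sup>2 * D\<^sup>2 - a * D * E + d * E) / (D\<^sup>2 * E)"
      using D Epos by (simp add: field_simps power2_eq_square)
    also have "a\<^sup>2 * D\<^sup>2 - a * D * E + d * E = d\<^sup>2"
      unfolding E by (simp add: algebra_simps power2_eq_square)
    finally show ?thesis .
  qed
  \<comment> \<open>Here the weight \<open>s\<close> disappears, by \<open>s \<le> D\<close> and
    \<open>u * a \<le> E\<close>.\<close>
  have "d\<^sup>2 / (D\<^sup>2 * E) = (s\<^sup>2 / D\<^sup>2) * ((b - a)\<^sup>2 / E)"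
    by (simp add: d_def power_mult_distrib)
  also have "\<dots> \<le> 1 * ((b - a)\<^sup>2 / (u * a))"
  proof (rule mult_mono)
    have "s\<^sup>2 \<le> D\<^sup>2" using pos s by (intro power_mono) (auto simp: D_def)
    then show "s\<^sup>2 / D\<^sup>2 \<le> 1" using D by simp
    show "(b - a)\<^sup>2 / E \<le> (b - a)\<^sup>2 / (u * a)" using ua Epos by (intro divide_left_mono) auto
  qed (use Epos in auto)
  finally have "4 * u\<^sup>2 * (d\<^sup>2 / (D\<^sup>2 * E)) \<le> 4 * u\<^sup>2 * ((b - a)\<^sup>2 / (u * a))"
    by (intro mult_left_mono) auto
  also have "\<dots> = 4 * (u * ((b - a)\<^sup>2 / a))"
    using pos by (simp add: field_simps power2_eq_square)
  finally have main: "4 * u\<^sup>2 * (a\<^sup>2 / E - a / D + d / D\<^sup>2) \<le> 4 * (u * ((b - a)\<^sup>2 / a))"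
    unfolding id .
  have "s * b - 3 * (u * a) + 4 * (u * a)\<^sup>2 / E
      - (a * (s - 3 * u + 4 * u\<^sup>2 / D) + s * (1 - 4 * u\<^sup>2 / D\<^sup>2) * (b - a))
      = 4 * u\<^sup>2 * (a\<^sup>2 / E - a / D + d / D\<^sup>2)"
    unfolding d_def by (simp add: algebra_simps power_mult_distrib)
  then have "s * b - 3 * (u * a) + 4 * (u * a)\<^sup>2 / E
      \<le> a * (s - 3 * u + 4 * u\<^sup>2 / D) + s * (1 - 4 * u\<^sup>2 / D\<^sup>2) * (b - a)
        + 4 * (u * ((b - a)\<^sup>2 / a))"
    using main by linarith
  then have "(s * b - 3 * (u * a) + 4 * (u * a)\<^sup>2 / E) / (2 * \<eta>)
      \<le> (a * (s - 3 * u + 4 * u\<^sup>2 / D) + s * (1 - 4 * u\<^sup>2 / D\<^sup>2) * (b - a)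
        + 4 * (u * ((b - a)\<^sup>2 / a))) / (2 * \<eta>)"
    using l by (intro divide_right_mono) auto
  moreover have "\<eta> * (u * a + s * b) / 2 = a * (\<eta> * (u + s) / 2) + \<eta> * s / 2 * (b - a)"
    by (simp add: field_simps)
  ultimately show ?thesis
    unfolding potential_def E_def D_def by (simp add: add_divide_distrib distrib_left distrib_right)
qed

lemma expectation_map_query:
  fixes F :: "bool \<Rightarrow> real"
  shows "measure_pmf.expectation (map_pmf h D) F
    = query_prob D h * F True + query_prob D (\<lambda>x. \<not> h x) * F False"
proof -
  have "measure_pmf.expectation (map_pmf h D) F
      = measure_pmf.expectation D (\<lambda>x. of_bool (h x) * F True + of_bool (\<not> h x) * F False)"
    unfolding integral_map_pmf by (rule Bochner_Integration.integral_cong) auto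
  also have "\<dots> = query_prob D h * F True + query_prob D (\<lambda>x. \<not> h x) * F False"
    by (subst Bochner_Integration.integral_add)
       (auto intro!: integrable_mult_left integrable_measure_pmf_bounded[where B = 1])
  finally show ?thesis .
qed

text \<open>
  The weights \<open>u\<close> and \<open>s x\<close> are the probabilities of the transcript so far under the reference
  and the \<open>x\<close>-th source; a query increases the total potential by its chi-square divergence.
\<close>

lemma sum_run_one_stat_le:
  fixes D :: "'s \<Rightarrow> 'x pmf" and D0 :: "'x pmf"
  assumes l: "0 < \<eta>" and fin: "finite \<Sigma>"
    and ac: "\<And>h x. x \<in> \<Sigma> \<Longrightarrow> query_prob D0 h = 0 \<Longrightarrow> query_prob (D x) h = 0"
    and chi: "\<And>h. (\<Sum>x\<in>\<Sigma>. (query_prob (D x) h - query_prob D0 h)\<^sup>2 / query_prob D0 h) \<le> B"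
    and u: "0 \<le> u" and s: "\<And>x. x \<in> \<Sigma> \<Longrightarrow> 0 \<le> s x"
  shows "(\<Sum>x\<in>\<Sigma>. s x * pmf (run m A (one_stat (D x)) H) (Some b)
            - u * pmf (run m A (one_stat D0) H) (Some b))
    \<le> (\<Sum>x\<in>\<Sigma>. potential \<eta> u (s x)) + real m * (u * (4 * B / \<eta>))"
  using u s
proof (induction m arbitrary: H u s)
  case 0
  let ?f = "\<lambda>move. case move of Inl q \<Rightarrow> 0 | Inr b' \<Rightarrow> (of_bool (b' = b) :: real)"
  have f: "0 \<le> measure_pmf.expectation (A H) ?f" "measure_pmf.expectation (A H) ?f \<le> 1"
    using pmf_nonneg[of "run 0 A (one_stat D0) H" "Some b"] pmf_le_1[of "run 0 A (one_stat D0) H" "Some b"]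
    unfolding pmf_run_0 by auto
  have "s x * measure_pmf.expectation (A H) ?f - u * measure_pmf.expectation (A H) ?f
      \<le> potential \<eta> u (s x)" if "x \<in> \<Sigma>" for x
  proof -
    have "(s x - u) * measure_pmf.expectation (A H) ?f \<le> potential \<eta> u (s x)"
    \<comment> \<open>The acceptance probability lies in \<open>[0, 1]\<close>: a negative
      difference is covered by nonnegativity of the potential, a positive one by its domination of
      \<open>s x - u\<close>.\<close>
    proof (cases "s x \<le> u")
      case True
      then have "(s x - u) * measure_pmf.expectation (A H) ?f \<le> 0"
        using f(1) by (intro mult_nonpos_nonneg) auto
      then show ?thesis using potential_ge(2)[OF l 0(1) 0(2)[OF that]] by linarith
    next
      case False
      then have "(s x - u) * measure_pmf.expectation (A H) ?f \<le> s x - u"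
        using f(2) by (intro mult_left_le) auto
      then show ?thesis using potential_ge(1)[OF l 0(1) 0(2)[OF that]] by linarith
    qed
    then show ?thesis by (simp add: left_diff_distrib)
  qed
  then show ?case unfolding pmf_run_0 by (simp add: sum_mono)
next
  case (Suc m)
  define g where "g m x H = pmf (run m A (one_stat (D x)) H) (Some b)" for m x H
  define g0 where "g0 m H = pmf (run m A (one_stat D0) H) (Some b)" for m H
  let ?p = "\<lambda>x h. query_prob (D x) h" and ?pU = "\<lambda>h. query_prob D0 h"
  define f where "f x move = (case move of
      Inl h \<Rightarrow> ?p x h * g m x (H @ [(h, True)]) + ?p x (\<lambda>y. \<not> h y) * g m x (H @ [(h, False)])
    | Inr b' \<Rightarrow> of_bool (b' = b))" for x move
  define f0 where "f0 move = (case move of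
      Inl h \<Rightarrow> ?pU h * g0 m (H @ [(h, True)]) + ?pU (\<lambda>y. \<not> h y) * g0 m (H @ [(h, False)])
    | Inr b' \<Rightarrow> of_bool (b' = b))" for move
  let ?V = "\<Sum>x\<in>\<Sigma>. potential \<eta> u (s x)" and ?K = "4 * B / \<eta>"
  have g01: "0 \<le> g m x H" "g m x H \<le> 1" "0 \<le> g0 m H" "g0 m H \<le> 1" for m x H
    by (auto simp: g_def g0_def pmf_le_1)
  have B0: "0 \<le> B"
    using order_trans[OF _ chi[of "\<lambda>_. True"]] by (simp add: sum_nonneg)
  have g_Suc: "g (Suc m) x H = measure_pmf.expectation (A H) (f x)" for x
    unfolding g_def pmf_run_Suc f_def one_stat_def expectation_map_query by simp
  have g0_Suc: "g0 (Suc m) H = measure_pmf.expectation (A H) f0"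
    unfolding g0_def pmf_run_Suc f0_def one_stat_def expectation_map_query by simp
  have convex: "0 \<le> query_prob M h * c + query_prob M (\<lambda>y. \<not> h y) * c'
      \<and> query_prob M h * c + query_prob M (\<lambda>y. \<not> h y) * c' \<le> 1"
    if "0 \<le> c" "c \<le> 1" "0 \<le> c'" "c' \<le> 1" for M and h :: "'x query" and c c' :: real
    using that convex_bound_le[of c 1 c' "query_prob M h" "1 - query_prob M h"]
      query_prob_nonneg[of M h] query_prob_le_1[of M h]
    unfolding query_prob_not by simp
  have int: "integrable (A H) (f x)" "integrable (A H) f0" for x
    using convex
    by (auto intro!: integrable_measure_pmf_bounded[where B = 1] split: sum.split
        simp: f_def f0_def g01 abs_of_nonneg)
  have "(\<Sum>x\<in>\<Sigma>. s x * f x move - u * f0 move) \<le> ?V + real (Suc m) * (u * ?K)" for move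
  proof (cases move)
    case (Inl h)
    \<comment> \<open>An answer multiplies each weight by its probability under that source, which
      is why the induction runs over arbitrary weights.\<close>
    have step: "(\<Sum>x\<in>\<Sigma>. (s x * ?p x h') * g m x H' - (u * ?pU h') * g0 m H')
        \<le> ?pU h' * ?V
          + (\<Sum>x\<in>\<Sigma>. (s x * (1 - 4 * u\<^sup>2 / (u + s x)\<^sup>2) / (2 * \<eta>) + \<eta> * s x / 2) * (?p x h' - ?pU h'))
          + 2 / \<eta> * (u * B) + ?pU h' * (real m * (u * ?K))" for h' H'
    proof -
      have "(\<Sum>x\<in>\<Sigma>. (s x * ?p x h') * g m x H' - (u * ?pU h') * g0 m H')
          \<le> (\<Sum>x\<in>\<Sigma>. potential \<eta> (u * ?pU h') (s x * ?p x h')) + real m * ((u * ?pU h') * ?K)"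
        unfolding g_def g0_def
        by (rule Suc.IH) (auto intro!: mult_nonneg_nonneg Suc.prems query_prob_nonneg)
      also have "(\<Sum>x\<in>\<Sigma>. potential \<eta> (u * ?pU h') (s x * ?p x h'))
          \<le> (\<Sum>x\<in>\<Sigma>. ?pU h' * potential \<eta> u (s x)
            + (s x * (1 - 4 * u\<^sup>2 / (u + s x)\<^sup>2) / (2 * \<eta>) + \<eta> * s x / 2) * (?p x h' - ?pU h')
            + 2 / \<eta> * (u * ((?p x h' - ?pU h')\<^sup>2 / ?pU h')))"
        using ac by (intro sum_mono potential_step l Suc.prems query_prob_nonneg) auto
      also have "\<dots> = ?pU h' * ?V
          + (\<Sum>x\<in>\<Sigma>. (s x * (1 - 4 * u\<^sup>2 / (u + s x)\<^sup>2) / (2 * \<eta>) + \<eta> * s x / 2) * (?p x h' - ?pU h'))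
          + 2 / \<eta> * (u * (\<Sum>x\<in>\<Sigma>. (?p x h' - ?pU h')\<^sup>2 / ?pU h'))"
        by (simp only: sum.distrib sum_distrib_left)
      also have "2 / \<eta> * (u * (\<Sum>x\<in>\<Sigma>. (?p x h' - ?pU h')\<^sup>2 / ?pU h')) \<le> 2 / \<eta> * (u * B)"
        using l Suc.prems(1) chi[of h'] by (intro mult_left_mono) auto
      finally show ?thesis by (simp add: mult_ac)
    qed
    have "(\<Sum>x\<in>\<Sigma>. s x * f x move - u * f0 move)
        = (\<Sum>x\<in>\<Sigma>. (s x * ?p x h) * g m x (H @ [(h, True)]) - (u * ?pU h) * g0 m (H @ [(h, True)]))
        + (\<Sum>x\<in>\<Sigma>. (s x * ?p x (\<lambda>y. \<not> h y)) * g m x (H @ [(h, False)])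
                 - (u * ?pU (\<lambda>y. \<not> h y)) * g0 m (H @ [(h, False)]))"
      unfolding sum.distrib[symmetric] by (simp add: Inl f_def f0_def algebra_simps)
    also have "\<dots> \<le> (?pU h + ?pU (\<lambda>y. \<not> h y)) * ?V
        + (\<Sum>x\<in>\<Sigma>. (s x * (1 - 4 * u\<^sup>2 / (u + s x)\<^sup>2) / (2 * \<eta>) + \<eta> * s x / 2)
             * (?p x h - ?pU h + (?p x (\<lambda>y. \<not> h y) - ?pU (\<lambda>y. \<not> h y))))
        + 4 / \<eta> * (u * B) + (?pU h + ?pU (\<lambda>y. \<not> h y)) * (real m * (u * ?K))"
      using add_mono[OF step[of h "H @ [(h, True)]"] step[of "\<lambda>y. \<not> h y" "H @ [(h, False)]"]]
      by (simp only: distrib_left distrib_right sum.distrib) (simp add: algebra_simps)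
    \<comment> \<open>Under every source the two answers have total probability one, so the linear
      terms cancel. What is left are the two remainders, \<open>2 / \<eta> * (u * B)\<close>
      each.\<close>
    also have "\<dots> = ?V + real (Suc m) * (u * ?K)"
      unfolding query_prob_not by (simp add: algebra_simps add_divide_distrib)
    finally show ?thesis .
  next
    case (Inr b')
    have "(\<Sum>x\<in>\<Sigma>. s x * f x move - u * f0 move) \<le> ?V"
      using potential_ge[OF l Suc.prems(1) Suc.prems(2)]
      by (intro sum_mono) (auto simp: Inr f_def f0_def)
    moreover have "0 \<le> real (Suc m) * (u * ?K)" using Suc.prems(1) B0 l by simp
    ultimately show ?thesis by linarith
  qed
  then have "measure_pmf.expectation (A H) (\<lambda>move. \<Sum>x\<in>\<Sigma>. s x * f x move - u * f0 move)
      \<le> measure_pmf.expectation (A H) (\<lambda>move. ?V + real (Suc m) * (u * ?K))"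
    using int by (intro integral_mono) auto
  then show ?case
    using int unfolding g_def[symmetric] g0_def[symmetric] g_Suc g0_Suc by simp
qed

section \<open>The two lower bounds\<close>

lemma vstat_tolerance_nonneg: "0 < t \<Longrightarrow> 0 \<le> vstat_tolerance t p"
  by (simp add: vstat_tolerance_def max.coboundedI1)

lemma vstat_tolerance_complement: "vstat_tolerance t (1 - p) = vstat_tolerance t p"
  by (simp add: vstat_tolerance_def mult.commute)

text \<open>The tolerance is taken at \<open>p'\<close>, whereas the moment bound is in terms of
  \<open>p\<close>. If \<open>\<bar>p' - p\<bar> \<ge> p / 2\<close>, the part \<open>1 / t\<close>
  of the tolerance suffices; otherwise \<open>p' \<ge> p / 2\<close> and
  \<open>1 - p' \<ge> 1 / 4\<close>, and the variance part does.\<close>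

lemma square_ge_of_exceeds_tolerance:
  assumes t: "0 < t" and p: "0 \<le> p" "p \<le> 1 / 2" and p': "0 \<le> p'" "p' \<le> 1"
    and exceeds: "vstat_tolerance t p' < \<bar>p' - p\<bar>"
  shows "p / (8 * t) \<le> (p' - p)\<^sup>2"
proof -
  have 1: "1 / t < \<bar>p' - p\<bar>" and 2: "sqrt (p' * (1 - p') / t) < \<bar>p' - p\<bar>"
    using exceeds by (auto simp: vstat_tolerance_def)
  show ?thesis
  proof (cases "p / 2 \<le> \<bar>p' - p\<bar>")
    case True
    have "p / (8 * t) \<le> p / 2 * (1 / t)" using t p by (simp add: field_simps)
    also have "\<dots> \<le> \<bar>p' - p\<bar> * \<bar>p' - p\<bar>"
      using True 1 t p by (intro mult_mono) auto
    finally show ?thesis by (simp add: power2_eq_square)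
  next
    case False
    then have "p / 2 \<le> p'" "1 / 4 \<le> 1 - p'" using p by (auto simp: abs_if split: if_splits)
    then have "p / 2 * (1 / 4) \<le> p' * (1 - p')" using p by (intro mult_mono) auto
    then have "p / (8 * t) \<le> p' * (1 - p') / t" using t by (simp add: field_simps)
    also have "\<dots> = (sqrt (p' * (1 - p') / t))\<^sup>2" using t p' by simp
    also have "\<dots> \<le> \<bar>p' - p\<bar>\<^sup>2" using 2 t p' by (intro power_mono) auto
    finally show ?thesis by simp
  qed
qed

text \<open>Markov's inequality for the \<open>2 * j\<close>-th moment. The uniform acceptance
  probability occurs to the power \<open>j\<close> in both the threshold and the moment and cancels.
  A query accepted with probability above \<open>1 / 2\<close> is replaced by its negation, which
  has the same tolerance and absolute deviation.\<close>

lemma card_exceeds_tolerance_le: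
  assumes k: "1 \<le> k" "k \<le> n" and Q: "set_pmf Q \<subseteq> cube k" "has_distribution_complexity k Q r"
    and j: "1 \<le> j" "(2 * real j - 1) * real k \<le> real n" and t: "0 < t"
  shows "real (card {\<sigma> \<in> cube n. vstat_tolerance t (query_prob (planted k n Q \<sigma>) h)
      < \<bar>query_prob (planted k n Q \<sigma>) h - query_prob (uniform_clauses k n) h\<bar>})
    \<le> 2 ^ n * (8 * t * 4 ^ k * ((2 * real j - 1) * real k / real n) ^ r) ^ j"
proof -
  let ?p = "\<lambda>\<sigma> h. query_prob (planted k n Q \<sigma>) h" and ?u = "\<lambda>h. query_prob (uniform_clauses k n) h"
  let ?bad = "\<lambda>h. {\<sigma> \<in> cube n. vstat_tolerance t (?p \<sigma> h) < \<bar>?p \<sigma> h - ?u h\<bar>}"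
  let ?y = "((2 * real j - 1) * real k / real n) ^ r"
  have y: "0 \<le> ?y" using j(1) by simp
  have half: "real (card (?bad h)) \<le> 2 ^ n * (8 * t * 4 ^ k * ?y) ^ j" if "?u h \<le> 1 / 2" for h
  proof -
    note moment = query_deviation_moment[OF k Q j, of h]
    have "real (card (?bad h)) * (?u h / (8 * t)) ^ j \<le> (\<Sum>\<sigma>\<in>?bad h. (?p \<sigma> h - ?u h) ^ (2 * j))"
      using t that unfolding power_mult
      by (intro sum_bounded_below power_mono square_ge_of_exceeds_tolerance)
         (auto simp: query_prob_nonneg query_prob_le_1)
    also have "\<dots> \<le> (\<Sum>\<sigma>\<in>cube n. (?p \<sigma> h - ?u h) ^ (2 * j))"
      by (rule sum_mono2) (auto simp: finite_cube)
    also note moment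
    finally have main: "real (card (?bad h)) * (?u h / (8 * t)) ^ j \<le> 2 ^ n * (4 ^ k * ?u h * ?y) ^ j" .
    show ?thesis
    \<comment> \<open>A zero threshold makes Markov's inequality void, but then the moment bound
      forces all deviations to vanish.\<close>
    proof (cases "?u h = 0")
      case True
      have "(\<Sum>\<sigma>\<in>cube n. (?p \<sigma> h - ?u h) ^ (2 * j)) \<le> 0"
        using moment True j(1) by (simp add: zero_power)
      then have "(\<Sum>\<sigma>\<in>cube n. (?p \<sigma> h - ?u h) ^ (2 * j)) = 0"
        by (intro antisym sum_nonneg) auto
      then have "?p \<sigma> h - ?u h = 0" if "\<sigma> \<in> cube n" for \<sigma>
        using that by (subst (asm) sum_nonneg_eq_0_iff) (auto simp: finite_cube)
      then have "\<sigma> \<notin> ?bad h" for \<sigma>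
        using vstat_tolerance_nonneg[OF t] by (auto simp: not_less)
      then have "?bad h = {}" by blast
      then have "real (card (?bad h)) = 0" by (simp only: card.empty)
      then show ?thesis using t y by simp
    next
      case False
      then have "0 < ?u h" using query_prob_nonneg[of "uniform_clauses k n" h] by linarith
      then have pos: "0 < (?u h / (8 * t)) ^ j" using t by simp
      have "4 ^ k * ?u h * ?y = (8 * t * 4 ^ k * ?y) * (?u h / (8 * t))"
        using t by simp
      then have "real (card (?bad h)) * (?u h / (8 * t)) ^ j
          \<le> (2 ^ n * (8 * t * 4 ^ k * ?y) ^ j) * (?u h / (8 * t)) ^ j"
        using main by (simp only: power_mult_distrib mult.assoc)
      then show ?thesis using pos by (rule mult_right_le_imp_le)
    qed
  qed
  show ?thesis
  proof (cases "?u h \<le> 1 / 2")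
    case False
    have "?bad (\<lambda>C. \<not> h C) = ?bad h"
      by (simp add: query_prob_not vstat_tolerance_complement abs_minus_commute)
    moreover have "?u (\<lambda>C. \<not> h C) \<le> 1 / 2" using False by (simp add: query_prob_not)
    ultimately show ?thesis using half[of "\<lambda>C. \<not> h C"] by simp
  qed (rule half)
qed

text \<open>Against the adversary \<open>v\<close>, only assignments counted by \<open>P\<close> can
  leave the uniform transcript at a given query. The losses of \<open>m\<close> queries together
  have to make up the advantage \<open>1 / 3\<close>.\<close>

lemma vstat_calls_ge:
  assumes t: "0 < t"
    and P: "\<And>h. real (card {\<sigma> \<in> cube n. vstat_tolerance t (query_prob (planted k n Q \<sigma>) h)
      < \<bar>query_prob (planted k n Q \<sigma>) h - query_prob (uniform_clauses k n) h\<bar>}) \<le> P"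
    and solves: "solves_with_vstat k n Q t m A"
  shows "2 ^ n / 3 \<le> real m * P"
proof -
  let ?U = "uniform_clauses k n"
  define v where "v D H h = (if vstat_tolerance t (query_prob D h) < \<bar>query_prob D h - query_prob ?U h\<bar>
    then query_prob D h else query_prob ?U h)"
    for D and H :: "(clause query, real) transcript" and h
  let ?g = "\<lambda>D. pmf (run m A (\<lambda>H h. return_pmf (v D H h)) []) (Some True)"
  have "valid_vstat t D (v D)" for D
    unfolding valid_vstat_def v_def Let_def
    using vstat_tolerance_nonneg[OF t, of "query_prob D _"]
    by (auto simp: not_less abs_le_iff)
  then have "2 / 3 \<le> success_prob k n Q m A (\<lambda>D H h. return_pmf (v D H h))"
    using solves unfolding solves_with_vstat_def by blast
  then have "2 ^ n * (1 / 3)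
      \<le> 2 ^ n * (2 * success_prob k n Q m A (\<lambda>D H h. return_pmf (v D H h)) - 1)"
    by (intro mult_left_mono) auto
  also note success_prob_le
  finally have "2 ^ n / 3 + 2 ^ n * ?g ?U \<le> (\<Sum>\<sigma>\<in>cube n. ?g (planted k n Q \<sigma>))" by simp
  also have "\<dots> \<le> real (card (cube n)) * ?g ?U + real m * P"
  proof (rule sum_run_deterministic_le[OF finite_cube])
    fix H :: "(clause query, real) transcript" and h
    have "{\<sigma> \<in> cube n. v (planted k n Q \<sigma>) H h \<noteq> v ?U H h}
        \<subseteq> {\<sigma> \<in> cube n. vstat_tolerance t (query_prob (planted k n Q \<sigma>) h)
            < \<bar>query_prob (planted k n Q \<sigma>) h - query_prob ?U h\<bar>}"
      by (auto simp: v_def split: if_splits)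
    then have "card {\<sigma> \<in> cube n. v (planted k n Q \<sigma>) H h \<noteq> v ?U H h}
        \<le> card {\<sigma> \<in> cube n. vstat_tolerance t (query_prob (planted k n Q \<sigma>) h)
            < \<bar>query_prob (planted k n Q \<sigma>) h - query_prob ?U h\<bar>}"
      by (intro card_mono) (auto simp: finite_cube)
    then show "real (card {\<sigma> \<in> cube n. v (planted k n Q \<sigma>) H h \<noteq> v ?U H h}) \<le> P"
      using P[of h] by linarith
  qed
  finally show ?thesis by (simp add: card_cube algebra_simps)
qed

text \<open>The moment order is \<open>j = \<lceil>ln q\<rceil>\<close>: once the base of the Markov
  bound is at most \<open>exp (-1)\<close>, each query separates at most a fraction
  \<open>exp (- j) \<le> 1 / q\<close> of the assignments.\<close>

lemma vstat_lower_bound: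
  assumes k: "1 \<le> k" "k \<le> n" and Q: "set_pmf Q \<subseteq> cube k" "has_distribution_complexity k Q r"
    and q: "1 \<le> q" and t: "0 < t"
    and small: "t * (ln q) ^ r \<le> 1 / (24 * 4 ^ k * (4 * real k) ^ r) * real n ^ r"
    and solves: "solves_with_vstat k n Q t m A"
  shows "q / 9 \<le> real m"
proof -
  let ?bad = "\<lambda>h. {\<sigma> \<in> cube n. vstat_tolerance t (query_prob (planted k n Q \<sigma>) h)
      < \<bar>query_prob (planted k n Q \<sigma>) h - query_prob (uniform_clauses k n) h\<bar>}"
  have n: "0 < n" using k by simp
  have r: "0 < r" using Q(2) by (simp add: has_distribution_complexity_def)
  show ?thesis
  \<comment> \<open>For \<open>q < 3\<close>, counting all assignments as separated already gives
    \<open>m \<ge> 1 / 3\<close>. From \<open>3\<close> on, \<open>ln q \<ge> 1\<close> ensures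
    \<open>j \<le> 2 * ln q\<close>.\<close>
  proof (cases "q < 3")
    case True
    have "real (card (?bad h)) \<le> 2 ^ n" for h
    proof -
      have "real (card (?bad h)) \<le> real (card (cube n))"
        by (intro of_nat_mono card_mono) (auto simp: finite_cube)
      then show ?thesis by (simp add: card_cube)
    qed
    then have "2 ^ n / 3 \<le> real m * 2 ^ n" by (rule vstat_calls_ge[OF t _ solves])
    then show ?thesis using True by simp
  next
    case False
    have "exp 1 \<le> q" using False exp_le by linarith
    then have lnq: "1 \<le> ln q" using q by (simp add: ln_ge_iff)
    define j where "j = nat \<lceil>ln q\<rceil>"
    have j: "ln q \<le> real j" "real j \<le> 2 * ln q" "1 \<le> j" using lnq unfolding j_def by linarith+
    show ?thesis
    \<comment> \<open>For \<open>t < 1\<close> the tolerance is at least one and no query separates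
      anything. For \<open>t \<ge> 1\<close> the hypothesis \<open>small\<close> yields
      \<open>4 * k * ln q \<le> n\<close>, which makes the \<open>2 * j\<close>-th moment bound
      available.\<close>
    proof (cases "t < 1")
      case True
      have "?bad h = {}" for h
      proof -
        have "\<bar>query_prob (planted k n Q \<sigma>) h - query_prob (uniform_clauses k n) h\<bar> \<le> 1" for \<sigma>
          using query_prob_nonneg[of "planted k n Q \<sigma>" h] query_prob_le_1[of "planted k n Q \<sigma>" h]
            query_prob_nonneg[of "uniform_clauses k n" h] query_prob_le_1[of "uniform_clauses k n" h]
          by linarith
        moreover have "1 \<le> vstat_tolerance t p" for p
          using True t by (simp add: vstat_tolerance_def le_max_iff_disj)
        ultimately show ?thesis by (auto simp: not_less intro: order_trans)
      qed
      then have "real (card (?bad h)) \<le> 0" for h by (simp only: card.empty)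
      then have "2 ^ n / 3 \<le> real m * 0" by (rule vstat_calls_ge[OF t _ solves])
      then show ?thesis using zero_less_power[of "2 :: real" n] by linarith
    next
      case False
      have "1 * (4 * real k * ln q) ^ r \<le> t * (4 * real k * ln q) ^ r"
        using False lnq by (intro mult_right_mono) auto
      also have bound: "t * (4 * real k * ln q) ^ r \<le> real n ^ r / (24 * 4 ^ k)"
      proof -
        have "t * (4 * real k * ln q) ^ r = (4 * real k) ^ r * (t * (ln q) ^ r)"
          by (simp only: power_mult_distrib mult_ac)
        also have "\<dots> \<le> (4 * real k) ^ r * (1 / (24 * 4 ^ k * (4 * real k) ^ r) * real n ^ r)"
          by (intro mult_left_mono small) auto
        also have "\<dots> = real n ^ r / (24 * 4 ^ k)" using k(1) by simp
        finally show ?thesis .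
      qed
      also have "real n ^ r / (24 * 4 ^ k) \<le> real n ^ r / 1"
        by (intro divide_left_mono mult_ge1_I) auto
      finally have "4 * real k * ln q \<le> real n"
        using r lnq by simp
      moreover have le: "(2 * real j - 1) * real k \<le> 4 * real k * ln q"
        using j mult_right_mono[of "2 * real j - 1" "4 * ln q" "real k"] by (simp add: mult_ac)
      ultimately have jk: "(2 * real j - 1) * real k \<le> real n" by linarith
      \<comment> \<open>The factor \<open>(4 * k) ^ r\<close> in \<open>small\<close> absorbs
        \<open>(2 * j - 1) * k \<le> 4 * k * ln q\<close>, and \<open>24 = 3 * 8\<close> leaves
        \<open>1 / 3\<close>, which is below \<open>exp (-1)\<close>.\<close>
      let ?z = "8 * t * 4 ^ k * ((2 * real j - 1) * real k / real n) ^ r"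
      have z0: "0 \<le> ?z" using t j(3) by simp
      have "?z \<le> 8 * t * 4 ^ k * (4 * real k * ln q / real n) ^ r"
        using le t j(3) by (intro mult_left_mono power_mono divide_right_mono) auto
      also have "\<dots> = 8 * 4 ^ k * (t * (4 * real k * ln q) ^ r) / real n ^ r"
        by (simp add: power_divide)
      also have "\<dots> \<le> 8 * 4 ^ k * (real n ^ r / (24 * 4 ^ k)) / real n ^ r"
        by (intro divide_right_mono mult_left_mono bound) auto
      also have "\<dots> = 1 / 3" using n by simp
      also have "\<dots> \<le> exp (-1)" using exp_le by (simp add: exp_minus field_simps)
      finally have "?z ^ j \<le> exp (-1) ^ j" using z0 by (intro power_mono)
      also have "\<dots> = exp (- real j)" by (simp flip: exp_of_nat_mult)
      also have "\<dots> \<le> exp (- ln q)" using j(1) by simp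
      also have "\<dots> = 1 / q" using q by (simp add: exp_minus inverse_eq_divide)
      finally have "2 ^ n * ?z ^ j \<le> 2 ^ n * (1 / q)" by (intro mult_left_mono) auto
      then have "real (card (?bad h)) \<le> 2 ^ n * (1 / q)" for h
        using card_exceeds_tolerance_le[OF k Q j(3) jk t, of h] by linarith
      then have "2 ^ n / 3 \<le> real m * (2 ^ n * (1 / q))"
        by (rule vstat_calls_ge[OF t _ solves])
      then have "q / 3 \<le> real m" using q by (simp add: field_simps)
      then show ?thesis using q by simp
    qed
  qed
qed

text \<open>The second moment bounds the chi-square divergence summed over all assignments, and this
  feeds the potential argument started with unit weights.\<close>

lemma one_stat_lower_bound:
  assumes k: "1 \<le> k" "k \<le> n" and Q: "set_pmf Q \<subseteq> cube k" "has_distribution_complexity k Q r"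
    and solves: "solves_with_one_stat k n Q m A"
  shows "real n ^ r / (144 * 4 ^ k * real k ^ r) \<le> real m"
proof -
  let ?U = "uniform_clauses k n" and ?D = "\<lambda>\<sigma>. planted k n Q \<sigma>"
  let ?g = "\<lambda>D. pmf (run m A (one_stat D) []) (Some True)"
  let ?y = "(real k / real n) ^ r"
  have n: "0 < n" using k by simp
  have moment: "(\<Sum>\<sigma>\<in>cube n. (query_prob (?D \<sigma>) h - query_prob ?U h)\<^sup>2)
      \<le> 2 ^ n * (4 ^ k * query_prob ?U h * ?y)" for h
    using query_deviation_moment[OF k Q, of 1 h] k by simp
  have ac: "query_prob (?D \<sigma>) h = 0" if "\<sigma> \<in> cube n" "query_prob ?U h = 0" for \<sigma> h
  proof -
    have "(\<Sum>\<sigma>\<in>cube n. (query_prob (?D \<sigma>) h)\<^sup>2) = 0"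
      using moment[of h] that(2) by (intro antisym sum_nonneg) auto
    then show ?thesis using that(1) by (subst (asm) sum_nonneg_eq_0_iff) (auto simp: finite_cube)
  qed
  have chi: "(\<Sum>\<sigma>\<in>cube n. (query_prob (?D \<sigma>) h - query_prob ?U h)\<^sup>2 / query_prob ?U h)
      \<le> 2 ^ n * 4 ^ k * ?y" for h
  proof (cases "query_prob ?U h = 0")
    case False
    then have "0 < query_prob ?U h" using query_prob_nonneg[of ?U h] by linarith
    then show ?thesis
      using moment[of h] unfolding sum_divide_distrib[symmetric] by (simp add: divide_le_eq mult_ac)
  qed simp
  have "2 / 3 \<le> success_prob k n Q m A one_stat"
    using solves by (simp add: solves_with_one_stat_def)
  then have "2 ^ n * (1 / 3) \<le> 2 ^ n * (2 * success_prob k n Q m A one_stat - 1)"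
    by (intro mult_left_mono) auto
  also note success_prob_le
  also have "(\<Sum>\<sigma>\<in>cube n. ?g (?D \<sigma>)) - 2 ^ n * ?g ?U
      = (\<Sum>\<sigma>\<in>cube n. 1 * ?g (?D \<sigma>) - 1 * ?g ?U)"
    by (simp add: sum_subtractf card_cube)
  \<comment> \<open>With \<open>\<eta> = 1 / 6\<close> the initial potential is \<open>1 / 6\<close>
    per assignment, half of the required advantage \<open>1 / 3\<close>. The queries must supply the
    other half, each contributing \<open>4 / \<eta> = 24\<close> times the divergence bound.\<close>
  also have "\<dots> \<le> (\<Sum>\<sigma>\<in>cube n. potential (1 / 6) 1 1)
      + real m * (1 * (4 * (2 ^ n * 4 ^ k * ?y) / (1 / 6)))"
    by (rule sum_run_one_stat_le[OF _ finite_cube ac chi]) auto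
  also have "\<dots> = 2 ^ n * (1 / 6 + real m * (24 * 4 ^ k * ?y))"
    by (simp add: potential_def card_cube algebra_simps)
  finally have "2 ^ n * (1 / 3) \<le> 2 ^ n * (1 / 6 + real m * (24 * 4 ^ k * ?y))" by simp
  then have "1 / 3 \<le> 1 / 6 + real m * (24 * 4 ^ k * ?y)" by (rule mult_left_le_imp_le) simp
  then have "1 \<le> real m * (144 * 4 ^ k * ?y)" by simp
  then show ?thesis using n k(1) by (simp add: power_divide field_simps)
qed

text \<open>The VSTAT parameter is bounded through a product, so that \<open>q = 1\<close>, where
  \<open>ln q = 0\<close>, puts no restriction on \<open>t\<close>.\<close>

theorem theorem1p1:
  fixes k r :: nat and Q :: "int list pmf"
  assumes "k \<ge> 1"
    and "set_pmf Q \<subseteq> cube k"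
    and "has_distribution_complexity k Q r"
  shows "(\<exists>c>0. \<exists>\<gamma>>0. \<forall>n\<ge>k. \<forall>q::real\<ge>1. \<forall>t::real>0. \<forall>m A.
            t * (ln q) ^ r \<le> \<gamma> * real n ^ r \<longrightarrow>
            solves_with_vstat k n Q t m A \<longrightarrow> real m \<ge> c * q)
       \<and> (\<exists>c>0. \<forall>n\<ge>k. \<forall>m A.
            solves_with_one_stat k n Q m A \<longrightarrow> real m \<ge> c * (real n / ln (real n)) ^ r)"
proof (intro conjI)
  let ?\<gamma> = "1 / (24 * 4 ^ k * (4 * real k) ^ r)"
  show "\<exists>c>0. \<exists>\<gamma>>0. \<forall>n\<ge>k. \<forall>q::real\<ge>1. \<forall>t::real>0. \<forall>m A.
            t * (ln q) ^ r \<le> \<gamma> * real n ^ r \<longrightarrow>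
            solves_with_vstat k n Q t m A \<longrightarrow> real m \<ge> c * q"
  proof (rule exI[of _ "1 / 9"], rule conjI, simp, rule exI[of _ ?\<gamma>], intro conjI allI impI)
    show "0 < ?\<gamma>" using assms(1) by simp
    fix n q t m A
    assume "k \<le> n" "1 \<le> q" "0 < t" "t * (ln q) ^ r \<le> ?\<gamma> * real n ^ r"
      "solves_with_vstat k n Q t m A"
    then show "1 / 9 * q \<le> real m"
      using vstat_lower_bound[OF assms(1) _ assms(2,3)] by simp
  qed
  \<comment> \<open>For \<open>n \<ge> 2\<close>, \<open>ln n \<ge> 1 / 2\<close> gives
    \<open>n / ln n \<le> 2 * n\<close>; hence the factor \<open>2 ^ r\<close>.\<close>
  let ?c = "1 / (144 * 4 ^ k * real k ^ r * 2 ^ r)"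
  show "\<exists>c>0. \<forall>n\<ge>k. \<forall>m A.
            solves_with_one_stat k n Q m A \<longrightarrow> real m \<ge> c * (real n / ln (real n)) ^ r"
  proof (intro exI[of _ ?c] conjI allI impI)
    show "0 < ?c" using assms(1) by simp
    fix n m A
    assume n: "k \<le> n" and "solves_with_one_stat k n Q m A"
    then have m: "real n ^ r / (144 * 4 ^ k * real k ^ r) \<le> real m"
      by (intro one_stat_lower_bound[OF assms(1) _ assms(2,3)])
    have "real n / ln (real n) \<le> 2 * real n \<and> 0 \<le> real n / ln (real n)"
    proof (cases "n \<le> 1")
      case True
      \<comment> \<open>Here \<open>ln n = 0\<close>, and division by zero makes the quotient
        \<open>0\<close>.\<close>
      then have "n = 1" using n assms(1) by simp
      then show ?thesis by simp
    next
      case False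
      then have "ln 2 \<le> ln (real n)" by simp
      then have "1 / 2 \<le> ln (real n)" using ln2_ge_two_thirds by linarith
      then have "real n / ln (real n) \<le> real n / (1 / 2)" by (intro divide_left_mono) auto
      then show ?thesis using False by simp
    qed
    then have "(real n / ln (real n)) ^ r \<le> (2 * real n) ^ r" by (intro power_mono) auto
    then have "?c * (real n / ln (real n)) ^ r \<le> ?c * (2 * real n) ^ r"
      by (intro mult_left_mono) auto
    also have "\<dots> = real n ^ r / (144 * 4 ^ k * real k ^ r)"
      by (simp add: power_mult_distrib)
    finally show "?c * (real n / ln (real n)) ^ r \<le> real m" using m by linarith
  qed
qed

end
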